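(* Let $\mathbf{X}_i=(X_{i1},\dots,X_{ir(i)})$, $1\le i\le n$, be arbitrary random multi-variables in a tracial $W^*$-probability space $(\mathcal{M},\tau)$. Then $$\chi(\mathbf{X}_1\sqcup\cdots\sqcup\mathbf{X}_n)\ \le\ \chi_{\mathrm{orb}}(\mathbf{X}_1,\dots,\mathbf{X}_n)+\sum_{i=1}^n\chi(\mathbf{X}_i).$$
   Context: A tracial $W^*$-probability space $(\mathcal{M},\tau)$ is a von Neumann algebra $\mathcal M$ with a faithful normal tracial state $\tau$. A random multi-variable is a finite tuple $\mathbf{X}=(X_1,\dots,X_r)$ of self-adjoint elements of $\mathcal{M}$; $\mathbf{X}_1\sqcup\cdots\sqcup\mathbf{X}_n$ is the concatenated tuple. $M_N^{\mathrm{sa}}$ is the space of self-adjoint $N\times N$ complex matrices, $(M_N^{\mathrm{sa}})_R=\{A\in M_N^{\mathrm{sa}}:\|A\|_\infty\le R\}$ (operator norm; $(M_N^{\mathrm{sa}})_\infty=M_N^{\mathrm{sa}}$), $\mathrm{tr}_N$ is the normalized trace, $\Lambda_N$ is the Lebesgue measure on $M_N^{\mathrm{sa}}\cong\mathbb{R}^{N^2}$ (Euclidean structure given by the inner product $\mathrm{Tr}(AB)$), $\gamma_{\mathrm{U}(N)}$ is the Haar probability measure on the unitary group $\mathrm{U}(N)$, $\mathcal{P}(\cdot)$ denotes the set of Borel probability measures, and $\log 0:=-\infty$. Microstates: for $0<R\le\infty$, $N,m\in\mathbb{N}$, $\delta>0$, $\Gamma_R(\mathbf{X}_1\sqcup\cdots\sqcup\mathbf{X}_n;N,m,\delta)$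 is the set of all $(\mathbf{A}_i)_{i=1}^n$ with $\mathbf{A}_i=(A_{i1},\dots,A_{ir(i)})\in((M_N^{\mathrm{sa}})_R)^{r(i)}$ such that $|\mathrm{tr}_N(A_{i_1j_1}\cdots A_{i_lj_l})-\tau(X_{i_1j_1}\cdots X_{i_lj_l})|<\delta$ whenever $1\le i_k\le n$, $1\le j_k\le r(i_k)$, $1\le k\le l$, $1\le l\le m$; similarly for a single multi-variable. Voiculescu's microstate free entropy of $\mathbf{X}=(X_1,\dots,X_r)$ is $$\chi(\mathbf{X})=\sup_{0<R<\infty}\ \lim_{\substack{m\to\infty\\ \delta\searrow0}}\ \limsup_{N\to\infty}\Big(\frac1{N^2}\log\Lambda_N^{\otimes r}(\Gamma_R(\mathbf{X};N,m,\delta))+\frac r2\log N\Big)\in[-\infty,\infty).$$ Orbital free entropy: let $\Phi_N:\mathrm{U}(N)^n\times\prod_{i=1}^n(M_N^{\mathrm{sa}})^{r(i)}\to\prod_{i=1}^n(M_N^{\mathrm{sa}})^{r(i)}$, $\Phi_N((U_i)_i,(\mathbf{A}_i)_i)=(U_i\mathbf{A}_iU_i^* )_i$ with $U_i\mathbf{A}_iU_i^*=(U_iA_{ij}U_i^* )_{j}$. Define $$\chi_{\mathrm{orb},R}(\mathbf{X}_1,\dots,\mathbf{X}_n;N,m,\delta)=\sup_{\mu\in\mathcal{P}(\prod_i(M_N^{\mathrm{sa}})^{r(i)})}\log\Big((\gamma_{\mathrm{U}(N)}^{\otimes n}\otimes\mu)\big(\Phi_N^{-1}(\Gamma_R(\mathbf{X}_1\sqcup\cdots\sqcup\mathbf{X}_n;N,m,\delta))\big)\Big),$$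 $$\chi_{\mathrm{orb},R}(\mathbf{X}_1,\dots,\mathbf{X}_n)=\inf_{m\in\mathbb{N},\,\delta>0}\ \limsup_{N\to\infty}\frac1{N^2}\chi_{\mathrm{orb},R}(\mathbf{X}_1,\dots,\mathbf{X}_n;N,m,\delta)$$ (the infimum is also the limit as $m\to\infty,\delta\searrow0$), and $\chi_{\mathrm{orb}}(\mathbf{X}_1,\dots,\mathbf{X}_n)=\sup_{0<R<\infty}\chi_{\mathrm{orb},R}(\mathbf{X}_1,\dots,\mathbf{X}_n)$. *)

theory Defs
  imports
    "HOL-Probability.Probability_Measure"
    "Jordan_Normal_Form.Schur_Decomposition"
begin

section \<open>Tracial $W^*$-probability spaces\<close>

text \<open>
  A complex Hilbert space. Norm and topology come from the underlying real inner product space,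
  whose inner product is the real part of the complex one. \<open>cinner\<close> is linear in the second
  argument.
\<close>

class complex_hilbert_space = real_inner + complete_space +
  fixes scaleC :: "complex \<Rightarrow> 'a \<Rightarrow> 'a"
    and cinner :: "'a \<Rightarrow> 'a \<Rightarrow> complex"
  assumes scaleC_add_right: "scaleC c (x + y) = scaleC c x + scaleC c y"
    and scaleC_add_left: "scaleC (c + d) x = scaleC c x + scaleC d x"
    and scaleC_scaleC: "scaleC c (scaleC d x) = scaleC (c * d) x"
    and scaleC_of_real: "scaleC (complex_of_real t) x = t *\<^sub>R x"
    and cinner_add_right: "cinner x (y + z) = cinner x y + cinner x z"
    and cinner_scaleC_right: "cinner x (scaleC c y) = c * cinner x y"
    and cinner_commute: "cinner x y = cnj (cinner y x)"
    and inner_eq_Re_cinner: "inner x y = Re (cinner x y)"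

instantiation complex :: complex_hilbert_space
begin

definition "scaleC_complex = ((*) :: complex \<Rightarrow> complex \<Rightarrow> complex)"

definition "cinner_complex x y = cnj x * (y :: complex)"

instance
  by standard
    (simp_all add: scaleC_complex_def cinner_complex_def inner_complex_def scaleR_conv_of_real
      algebra_simps)

end

text \<open>
  The library type of bounded operators is only real-linear, so the complex-linear ones are
  singled out.
\<close>

definition BH :: "('h::complex_hilbert_space \<Rightarrow>\<^sub>L 'h) set" where
  "BH = {a. \<forall>c x. blinfun_apply a (scaleC c x) = scaleC c (blinfun_apply a x)}"

definition cscale :: "complex \<Rightarrow> ('h::complex_hilbert_space \<Rightarrow>\<^sub>L 'h)" where
  "cscale c = Blinfun (scaleC c)"

definition op_adjoint ::
    "('h::complex_hilbert_space \<Rightarrow>\<^sub>L 'h) \<Rightarrow> ('h \<Rightarrow>\<^sub>L 'h)" where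
  "op_adjoint a = (THE b. b \<in> BH \<and>
     (\<forall>x y. cinner (blinfun_apply a x) y = cinner x (blinfun_apply b y)))"

definition op_le ::
    "('h::complex_hilbert_space \<Rightarrow>\<^sub>L 'h) \<Rightarrow> ('h \<Rightarrow>\<^sub>L 'h) \<Rightarrow> bool" where
  "op_le a b \<longleftrightarrow> (\<forall>x. let z = cinner x (blinfun_apply (b - a) x) in Im z = 0 \<and> 0 \<le> Re z)"

definition commutant ::
    "('h::complex_hilbert_space \<Rightarrow>\<^sub>L 'h) set \<Rightarrow> ('h \<Rightarrow>\<^sub>L 'h) set" where
  "commutant S = {b \<in> BH. \<forall>a\<in>S. b o\<^sub>L a = a o\<^sub>L b}"

text \<open>Being a commutant makes such a set a unital, weakly closed complex algebra.\<close>

definition von_neumann_algebra :: "('h::complex_hilbert_space \<Rightarrow>\<^sub>L 'h) set \<Rightarrow> bool" where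
  "von_neumann_algebra M \<longleftrightarrow>
     M \<subseteq> BH \<and> (\<forall>a\<in>M. op_adjoint a \<in> M) \<and> commutant (commutant M) = M"

definition self_adjoint_part ::
    "('h::complex_hilbert_space \<Rightarrow>\<^sub>L 'h) set \<Rightarrow> ('h \<Rightarrow>\<^sub>L 'h) set" where
  "self_adjoint_part M = {a \<in> M. op_adjoint a = a}"

text \<open>
  Normality: suprema of upward directed families of self-adjoint elements that have a least upper
  bound in the algebra are preserved.
\<close>

definition normal_on ::
    "('h::complex_hilbert_space \<Rightarrow>\<^sub>L 'h) set \<Rightarrow> (('h \<Rightarrow>\<^sub>L 'h) \<Rightarrow> complex) \<Rightarrow> bool" where
  "normal_on M \<tau> \<longleftrightarrow>
     (\<forall>D s. D \<subseteq> self_adjoint_part M \<longrightarrow> D \<noteq> {} \<longrightarrow>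
        (\<forall>a\<in>D. \<forall>b\<in>D. \<exists>c\<in>D. op_le a c \<and> op_le b c) \<longrightarrow>
        s \<in> self_adjoint_part M \<longrightarrow> (\<forall>a\<in>D. op_le a s) \<longrightarrow>
        (\<forall>t\<in>self_adjoint_part M. (\<forall>a\<in>D. op_le a t) \<longrightarrow> op_le s t) \<longrightarrow>
        Re (\<tau> s) = (SUP a\<in>D. Re (\<tau> a)))"

locale tracial_W_prob_space =
  fixes M :: "('h::complex_hilbert_space \<Rightarrow>\<^sub>L 'h) set"
    and \<tau> :: "('h \<Rightarrow>\<^sub>L 'h) \<Rightarrow> complex"
  assumes von_neumann: "von_neumann_algebra M"
    and add: "a \<in> M \<Longrightarrow> b \<in> M \<Longrightarrow> \<tau> (a + b) = \<tau> a + \<tau> b"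
    and scale: "a \<in> M \<Longrightarrow> \<tau> (cscale c o\<^sub>L a) = c * \<tau> a"
    and positive: "a \<in> M \<Longrightarrow> Im (\<tau> (op_adjoint a o\<^sub>L a)) = 0 \<and> 0 \<le> Re (\<tau> (op_adjoint a o\<^sub>L a))"
    and unital: "\<tau> id_blinfun = 1"
    and tracial: "a \<in> M \<Longrightarrow> b \<in> M \<Longrightarrow> \<tau> (a o\<^sub>L b) = \<tau> (b o\<^sub>L a)"
    and faithful: "a \<in> M \<Longrightarrow> \<tau> (op_adjoint a o\<^sub>L a) = 0 \<Longrightarrow> a = 0"
    and normal: "normal_on M \<tau>"

section \<open>Matrices\<close>

definition msa :: "nat \<Rightarrow> complex mat set" where
  "msa N = {A \<in> carrier_mat N N. mat_adjoint A = A}"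

definition unitary_group :: "nat \<Rightarrow> complex mat set" where
  "unitary_group N =
     {U \<in> carrier_mat N N. mat_adjoint U * U = 1\<^sub>m N \<and> U * mat_adjoint U = 1\<^sub>m N}"

definition vec_norm2 :: "complex Matrix.vec \<Rightarrow> real" where
  "vec_norm2 v = sqrt (Re (v \<bullet>c v))"

definition op_norm :: "nat \<Rightarrow> complex mat \<Rightarrow> real" where
  "op_norm N A = (SUP v\<in>{v \<in> carrier_vec N. vec_norm2 v \<le> 1}. vec_norm2 (A *\<^sub>v v))"

definition msa_ball :: "nat \<Rightarrow> ereal \<Rightarrow> complex mat set" where
  "msa_ball N R = {A \<in> msa N. ereal (op_norm N A) \<le> R}"

definition ntrace :: "nat \<Rightarrow> complex mat \<Rightarrow> complex" where
  "ntrace N A = (\<Sum>i<N. A $$ (i, i)) / of_nat N"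

text \<open>
  The Borel \<open>\<sigma>\<close>-algebra of a set \<open>S\<close> of \<open>N\<close>-by-\<open>N\<close> matrices, for the Euclidean topology: it is
  pulled back along the embedding of \<open>S\<close> by matrix entries into the function space
  \<open>nat \<times> nat \<Rightarrow> complex\<close>.
\<close>

definition mat_entries :: "nat \<Rightarrow> complex mat \<Rightarrow> nat \<times> nat \<Rightarrow> complex" where
  "mat_entries N A = (\<lambda>p. if p \<in> {..<N} \<times> {..<N} then A $$ p else 0)"

definition mat_borel :: "nat \<Rightarrow> complex mat set \<Rightarrow> complex mat measure" where
  "mat_borel N S = vimage_algebra S (mat_entries N) borel"

text \<open>
  Coordinates of \<open>msa N\<close> in an orthonormal basis for the inner product \<open>Tr (A B)\<close>: the diagonal
  entries, and \<open>\<surd>2\<close> times the real and imaginary parts of the entries above the diagonal; the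
  Lebesgue measure is the image of the product Lebesgue measure on these coordinates.
\<close>

definition msa_of_coords :: "nat \<Rightarrow> (nat \<times> nat \<Rightarrow> real) \<Rightarrow> complex mat" where
  "msa_of_coords N x = Matrix.mat N N (\<lambda>(i, j).
     if i = j then complex_of_real (x (i, i))
     else if i < j then Complex (x (i, j) / sqrt 2) (x (j, i) / sqrt 2)
     else Complex (x (j, i) / sqrt 2) (- (x (i, j) / sqrt 2)))"

definition Lebesgue_msa :: "nat \<Rightarrow> complex mat measure" where
  "Lebesgue_msa N =
     distr (Pi\<^sub>M ({..<N} \<times> {..<N}) (\<lambda>_. lborel)) (mat_borel N (msa N)) (msa_of_coords N)"

text \<open>
  A left-invariant Borel probability measure on the compact group \<open>unitary_group N\<close>; these
  properties determine it uniquely as the Haar probability measure.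
\<close>

definition haar_unitary :: "nat \<Rightarrow> complex mat measure \<Rightarrow> bool" where
  "haar_unitary N \<gamma> \<longleftrightarrow>
     prob_space \<gamma> \<and> sets \<gamma> = sets (mat_borel N (unitary_group N)) \<and>
     (\<forall>U\<in>unitary_group N. distr \<gamma> \<gamma> (\<lambda>V. U * V) = \<gamma>)"

section \<open>Microstates and entropies\<close>

text \<open>
  A tuple is a family indexed by a finite set \<open>I\<close>. The multi-variable \<open>X i\<close> has index set
  \<open>{1..r i}\<close>, and the concatenation of \<open>X 1, \<dots>, X n\<close> is the family \<open>\<lambda>(i, j). X i j\<close> on the index
  set of pairs \<open>SIGMA i:{1..n}. {1..r i}\<close>.
\<close>

definition op_word ::
    "('i \<Rightarrow> 'h::complex_hilbert_space \<Rightarrow>\<^sub>L 'h) \<Rightarrow> 'i list \<Rightarrow> ('h \<Rightarrow>\<^sub>L 'h)" where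
  "op_word X w = foldr (\<lambda>k a. X k o\<^sub>L a) w id_blinfun"

definition mat_word :: "nat \<Rightarrow> ('i \<Rightarrow> complex mat) \<Rightarrow> 'i list \<Rightarrow> complex mat" where
  "mat_word N A w = foldr (\<lambda>k B. A k * B) w (1\<^sub>m N)"

definition microstates ::
    "(('h::complex_hilbert_space \<Rightarrow>\<^sub>L 'h) \<Rightarrow> complex) \<Rightarrow> 'i set \<Rightarrow> ('i \<Rightarrow> 'h \<Rightarrow>\<^sub>L 'h) \<Rightarrow>
     ereal \<Rightarrow> nat \<Rightarrow> nat \<Rightarrow> real \<Rightarrow> ('i \<Rightarrow> complex mat) set" where
  "microstates \<tau> I X R N m \<delta> =
     {A \<in> Pi\<^sub>E I (\<lambda>_. msa_ball N R).
        \<forall>w. set w \<subseteq> I \<longrightarrow> 1 \<le> length w \<longrightarrow> length w \<le> m \<longrightarrow>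
          cmod (ntrace N (mat_word N A w) - \<tau> (op_word X w)) < \<delta>}"

definition elog :: "ennreal \<Rightarrow> ereal" where
  "elog x = (if x = 0 then -\<infinity> else if x = \<infinity> then \<infinity> else ereal (ln (enn2real x)))"

text \<open>
  The limit exists in the extended reals, the limit superior being monotone in \<open>m\<close> and \<open>\<delta>\<close>.
\<close>

definition free_entropy ::
    "(('h::complex_hilbert_space \<Rightarrow>\<^sub>L 'h) \<Rightarrow> complex) \<Rightarrow> 'i set \<Rightarrow> ('i \<Rightarrow> 'h \<Rightarrow>\<^sub>L 'h) \<Rightarrow> ereal" where
  "free_entropy \<tau> I X =
     (SUP R\<in>{0<..<\<infinity>}. Lim (sequentially \<times>\<^sub>F at_right 0) (\<lambda>(m, \<delta>).
        limsup (\<lambda>N. ereal (1 / real N ^ 2) *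
            elog (emeasure (Pi\<^sub>M I (\<lambda>_. Lebesgue_msa N)) (microstates \<tau> I X R N m \<delta>))
          + ereal (real (card I) / 2 * ln (real N)))))"

definition tuple_index :: "nat \<Rightarrow> (nat \<Rightarrow> nat) \<Rightarrow> (nat \<times> nat) set" where
  "tuple_index n r = (SIGMA i:{1..n}. {1..r i})"

text \<open>
  The product \<open>\<sigma>\<close>-algebra is the Borel \<open>\<sigma>\<close>-algebra of the product, all spaces being second countable.
\<close>

definition borel_probs :: "nat \<Rightarrow> 'i set \<Rightarrow> ('i \<Rightarrow> complex mat) measure set" where
  "borel_probs N I = {\<mu>. prob_space \<mu> \<and> sets \<mu> = sets (Pi\<^sub>M I (\<lambda>_. mat_borel N (msa N)))}"

definition conj_map ::
    "nat \<Rightarrow> (nat \<Rightarrow> nat) \<Rightarrow> (nat \<Rightarrow> complex mat) \<times> (nat \<times> nat \<Rightarrow> complex mat) \<Rightarrow>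
     nat \<times> nat \<Rightarrow> complex mat" where
  "conj_map n r = (\<lambda>(U, A). \<lambda>(i, j)\<in>tuple_index n r. U i * A (i, j) * mat_adjoint (U i))"

text \<open>The argument \<open>\<gamma> N\<close> stands for the Haar probability measure on \<open>unitary_group N\<close>.\<close>

definition orb_entropy_approx ::
    "(nat \<Rightarrow> complex mat measure) \<Rightarrow> (('h::complex_hilbert_space \<Rightarrow>\<^sub>L 'h) \<Rightarrow> complex) \<Rightarrow>
     nat \<Rightarrow> (nat \<Rightarrow> nat) \<Rightarrow> (nat \<Rightarrow> nat \<Rightarrow> 'h \<Rightarrow>\<^sub>L 'h) \<Rightarrow>
     ereal \<Rightarrow> nat \<Rightarrow> nat \<Rightarrow> real \<Rightarrow> ereal" where
  "orb_entropy_approx \<gamma> \<tau> n r X R N m \<delta> =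
     (SUP \<mu>\<in>borel_probs N (tuple_index n r).
        let P = Pi\<^sub>M {1..n} (\<lambda>_. \<gamma> N) \<Otimes>\<^sub>M \<mu> in
        elog (emeasure P
          (conj_map n r -` microstates \<tau> (tuple_index n r) (\<lambda>(i, j). X i j) R N m \<delta> \<inter> space P)))"

definition orb_entropy_R ::
    "(nat \<Rightarrow> complex mat measure) \<Rightarrow> (('h::complex_hilbert_space \<Rightarrow>\<^sub>L 'h) \<Rightarrow> complex) \<Rightarrow>
     nat \<Rightarrow> (nat \<Rightarrow> nat) \<Rightarrow> (nat \<Rightarrow> nat \<Rightarrow> 'h \<Rightarrow>\<^sub>L 'h) \<Rightarrow> ereal \<Rightarrow> ereal" where
  "orb_entropy_R \<gamma> \<tau> n r X R =
     (INF (m, \<delta>)\<in>{1..} \<times> {0<..}.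
        limsup (\<lambda>N. ereal (1 / real N ^ 2) * orb_entropy_approx \<gamma> \<tau> n r X R N m \<delta>))"

definition orb_free_entropy ::
    "(nat \<Rightarrow> complex mat measure) \<Rightarrow> (('h::complex_hilbert_space \<Rightarrow>\<^sub>L 'h) \<Rightarrow> complex) \<Rightarrow>
     nat \<Rightarrow> (nat \<Rightarrow> nat) \<Rightarrow> (nat \<Rightarrow> nat \<Rightarrow> 'h \<Rightarrow>\<^sub>L 'h) \<Rightarrow> ereal" where
  "orb_free_entropy \<gamma> \<tau> n r X = (SUP R\<in>{0<..<\<infinity>}. orb_entropy_R \<gamma> \<tau> n r X R)"

end

theory Submission
  imports Defs
begin

text \<open>
  Conjugating each block by a unitary matrix preserves Lebesgue measure. Let \<open>G\<close> be the set of joint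
  microstates and \<open>D \<supseteq> G\<close> the product of the microstate sets of the \<open>X i\<close>; both have finite measure
  because \<open>R < \<infinity>\<close>, and \<open>D\<close> is invariant under conjugation. If \<open>D\<close> is not a null set and \<open>\<mu>\<close> is the
  normalized restriction of Lebesgue measure to \<open>D\<close>, then for every tuple \<open>U\<close> the set of all \<open>A\<close> with
  \<open>U A U* \<in> G\<close> has \<open>\<mu>\<close>-measure \<open>vol G / vol D\<close>. So \<open>log (vol G)\<close> is the sum of the \<open>log (vol (G' i))\<close>,
  \<open>G' i\<close> being the factors of \<open>D\<close>, and of the logarithm of the probability that \<open>\<mu>\<close> contributes to the
  supremum in the orbital entropy. Limits superior are subadditive and monotonicity in \<open>(m, \<delta>)\<close> makes
  all the limits that occur limits superior.
\<close>

section \<open>Matrices\<close>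

lemma dim_mat_adjoint [simp]:
  "dim_row (mat_adjoint A) = dim_col A" "dim_col (mat_adjoint A) = dim_row A"
  by (simp_all add: mat_adjoint_def)

lemma mat_adjoint_index [simp]:
  fixes A :: "complex mat"
  assumes "i < dim_col A" "j < dim_row A"
  shows "mat_adjoint A $$ (i, j) = cnj (A $$ (j, i))"
  using assms by (simp add: mat_adjoint_def mat_of_rows_index)

lemma mat_adjoint_carrier [simp]:
  "mat_adjoint A \<in> carrier_mat m n \<longleftrightarrow> A \<in> carrier_mat n m"
  unfolding carrier_mat_def mem_Collect_eq dim_mat_adjoint by (rule conj_commute)

lemma mat_adjoint_mat_adjoint [simp]:
  fixes A :: "complex mat"
  shows "mat_adjoint (mat_adjoint A) = A"
  by (intro eq_matI) simp_all

lemma mat_adjoint_mult: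
  fixes A B :: "complex mat"
  assumes "A \<in> carrier_mat n k" "B \<in> carrier_mat k m"
  shows "mat_adjoint (A * B) = mat_adjoint B * mat_adjoint A"
  using assms by (intro eq_matI) (auto simp: scalar_prod_def mult.commute)

lemma unitary_groupD:
  assumes "U \<in> unitary_group N"
  shows "U \<in> carrier_mat N N" "mat_adjoint U * U = 1\<^sub>m N" "U * mat_adjoint U = 1\<^sub>m N"
  using assms by (auto simp: unitary_group_def)

lemma mat_adjoint_unitary_group: "U \<in> unitary_group N \<Longrightarrow> mat_adjoint U \<in> unitary_group N"
  by (auto simp: unitary_group_def)

lemma msa_carrier: "A \<in> msa N \<Longrightarrow> A \<in> carrier_mat N N"
  by (simp add: msa_def)

lemma msa_subset_carrier: "msa N \<subseteq> carrier_mat N N"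
  by (auto simp: msa_def)

text \<open>Sums, differences and negatives are checked entry by entry, so self-adjointness is put
  in that form.\<close>

lemma msa_iff:
  "A \<in> msa N \<longleftrightarrow> A \<in> carrier_mat N N \<and> (\<forall>i<N. \<forall>j<N. cnj (A $$ (j, i)) = A $$ (i, j))"
  by (auto simp: msa_def mat_eq_iff)

lemma msa_add: "A \<in> msa N \<Longrightarrow> B \<in> msa N \<Longrightarrow> A + B \<in> msa N"
  by (auto simp: msa_iff)

lemma msa_minus: "A \<in> msa N \<Longrightarrow> B \<in> msa N \<Longrightarrow> A - B \<in> msa N"
  by (auto simp: msa_iff)

lemma msa_uminus: "A \<in> msa N \<Longrightarrow> - A \<in> msa N"
  by (auto simp: msa_iff)

definition conj_mat :: "complex mat \<Rightarrow> complex mat \<Rightarrow> complex mat" where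
  "conj_mat U A = U * A * mat_adjoint U"

lemma conj_mat_carrier:
  "U \<in> unitary_group N \<Longrightarrow> A \<in> carrier_mat N N \<Longrightarrow> conj_mat U A \<in> carrier_mat N N"
  by (auto simp: conj_mat_def dest!: unitary_groupD(1))

lemma conj_mat_msa:
  assumes "U \<in> unitary_group N" "A \<in> msa N"
  shows "conj_mat U A \<in> msa N"
proof -
  note U = unitary_groupD[OF assms(1)]
  have A: "A \<in> carrier_mat N N" "mat_adjoint A = A" using assms(2) by (auto simp: msa_def)
  have "mat_adjoint (U * A * mat_adjoint U) = U * (A * mat_adjoint U)"
    using U(1) A by (simp add: mat_adjoint_mult[of _ N N _ N])
  then show ?thesis
    using U(1) A by (simp add: conj_mat_def msa_def assoc_mult_mat[of _ N N _ N _ N])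
qed

lemma conj_mat_add:
  assumes "U \<in> unitary_group N" "A \<in> carrier_mat N N" "B \<in> carrier_mat N N"
  shows "conj_mat U (A + B) = conj_mat U A + conj_mat U B"
  using assms(2,3) unitary_groupD(1)[OF assms(1)]
  by (simp add: conj_mat_def mult_add_distrib_mat[of _ N N _ N] add_mult_distrib_mat[of _ N N _ _ N])

lemma unitary_mult_cancel:
  assumes "U \<in> unitary_group N" "A \<in> carrier_mat N N"
  shows "mat_adjoint U * (U * A) = A" "U * (mat_adjoint U * A) = A"
proof -
  note U = unitary_groupD[OF assms(1)]
  show "mat_adjoint U * (U * A) = A"
    using U assms(2) by (simp flip: assoc_mult_mat[of _ N N _ N _ N])
  show "U * (mat_adjoint U * A) = A"
    using U assms(2) by (simp flip: assoc_mult_mat[of _ N N _ N _ N])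
qed

text \<open>The inner \<open>mat_adjoint U * U\<close> cancels. Together with
  \<open>conj_mat_one\<close> this lets conjugation pass through whole words.\<close>

lemma conj_mat_mult:
  assumes "U \<in> unitary_group N" "A \<in> carrier_mat N N" "B \<in> carrier_mat N N"
  shows "conj_mat U (A * B) = conj_mat U A * conj_mat U B"
  using assms(2,3) unitary_groupD(1)[OF assms(1)]
  by (simp add: conj_mat_def assoc_mult_mat[of _ N N _ N _ N] unitary_mult_cancel[OF assms(1)])

lemma conj_mat_one: "U \<in> unitary_group N \<Longrightarrow> conj_mat U (1\<^sub>m N) = 1\<^sub>m N"
  using unitary_groupD[of U N] by (simp add: conj_mat_def)

lemma conj_mat_adjoint_cancel:
  assumes "U \<in> unitary_group N" "A \<in> carrier_mat N N"
  shows "conj_mat (mat_adjoint U) (conj_mat U A) = A" "conj_mat U (conj_mat (mat_adjoint U) A) = A"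
proof -
  note U = unitary_groupD[OF assms(1)]
  show "conj_mat (mat_adjoint U) (conj_mat U A) = A"
    using U assms(2)
    by (simp add: conj_mat_def assoc_mult_mat[of _ N N _ N _ N] unitary_mult_cancel[OF assms(1)])
  show "conj_mat U (conj_mat (mat_adjoint U) A) = A"
    using U assms(2)
    by (simp add: conj_mat_def assoc_mult_mat[of _ N N _ N _ N] unitary_mult_cancel[OF assms(1)])
qed

lemma ntrace_mult_commute:
  assumes "A \<in> carrier_mat N N" "B \<in> carrier_mat N N"
  shows "ntrace N (A * B) = ntrace N (B * A)"
proof -
  have "(\<Sum>i<N. (A * B) $$ (i, i)) = (\<Sum>i<N. \<Sum>j<N. A $$ (i, j) * B $$ (j, i))"
    using assms by (intro sum.cong) (auto simp: scalar_prod_def atLeast0LessThan)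
  also have "\<dots> = (\<Sum>j<N. \<Sum>i<N. B $$ (j, i) * A $$ (i, j))"
    by (subst sum.swap) (simp add: mult.commute)
  also have "\<dots> = (\<Sum>i<N. (B * A) $$ (i, i))"
    using assms by (intro sum.cong) (auto simp: scalar_prod_def atLeast0LessThan)
  finally show ?thesis by (simp add: ntrace_def)
qed

text \<open>Cyclicity of the trace brings \<open>mat_adjoint U\<close> next to \<open>U\<close>.
  This is why the moments of a microstate do not change under conjugation.\<close>

lemma ntrace_conj_mat:
  assumes "U \<in> unitary_group N" "A \<in> carrier_mat N N"
  shows "ntrace N (conj_mat U A) = ntrace N A"
proof -
  have "ntrace N (conj_mat U A) = ntrace N (mat_adjoint U * (U * A))"
    using assms unitary_groupD(1)[OF assms(1)] unfolding conj_mat_def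
    by (intro ntrace_mult_commute) auto
  then show ?thesis by (simp add: unitary_mult_cancel[OF assms])
qed

section \<open>Euclidean norm and operator norm\<close>

lemma vec_norm2_eq: "vec_norm2 v = L2_set (\<lambda>i. cmod (v $ i)) {..<dim_vec v}"
  by (simp add: vec_norm2_def L2_set_def scalar_prod_def atLeast0LessThan complex_norm_square[symmetric])

lemma cscalar_prod_mult_mat_vec:
  fixes A :: "complex mat"
  assumes "A \<in> carrier_mat n m" "v \<in> carrier_vec m" "w \<in> carrier_vec n"
  shows "(A *\<^sub>v v) \<bullet>c w = v \<bullet>c (mat_adjoint A *\<^sub>v w)"
proof -
  have "(A *\<^sub>v v) \<bullet>c w = (\<Sum>i<n. \<Sum>j<m. A $$ (i, j) * v $ j * cnj (w $ i))"
    using assms by (auto simp: scalar_prod_def atLeast0LessThan sum_distrib_right intro!: sum.cong)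
  also have "\<dots> = (\<Sum>j<m. \<Sum>i<n. v $ j * (A $$ (i, j) * cnj (w $ i)))"
    by (subst sum.swap) (simp add: ac_simps)
  also have "\<dots> = v \<bullet>c (mat_adjoint A *\<^sub>v w)"
    using assms by (auto simp: scalar_prod_def atLeast0LessThan sum_distrib_left intro!: sum.cong)
  finally show ?thesis .
qed

lemma vec_norm2_unitary:
  assumes "U \<in> unitary_group N" "v \<in> carrier_vec N"
  shows "vec_norm2 (U *\<^sub>v v) = vec_norm2 v"
proof -
  note U = unitary_groupD[OF assms(1)]
  have "(U *\<^sub>v v) \<bullet>c (U *\<^sub>v v) = v \<bullet>c (mat_adjoint U *\<^sub>v (U *\<^sub>v v))"
    using U assms(2) by (intro cscalar_prod_mult_mat_vec) auto
  also have "mat_adjoint U *\<^sub>v (U *\<^sub>v v) = v"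
    using U assms(2) by (simp flip: assoc_mult_mat_vec[of _ N N _ N])
  finally show ?thesis by (simp add: vec_norm2_def)
qed

text \<open>A real supremum can be compared with \<open>R\<close> pointwise only over a nonempty
  bounded family. The sum of the moduli of all entries of \<open>A\<close> is a bound, since the
  entries of \<open>v\<close> have modulus at most 1.\<close>

lemma op_norm_le_iff:
  assumes "A \<in> carrier_mat N N"
  shows "op_norm N A \<le> R \<longleftrightarrow>
    (\<forall>v\<in>carrier_vec N. vec_norm2 v \<le> 1 \<longrightarrow> vec_norm2 (A *\<^sub>v v) \<le> R)"
proof -
  let ?V = "{v \<in> carrier_vec N. vec_norm2 v \<le> 1}"
  have "vec_norm2 (A *\<^sub>v v) \<le> (\<Sum>i<N. \<Sum>j<N. cmod (A $$ (i, j)))" if "v \<in> ?V" for v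
  proof -
    from that have v: "dim_vec v = N" "vec_norm2 v \<le> 1" by auto
    have le1: "cmod (v $ j) \<le> 1" if "j < N" for j
    proof -
      have "cmod (v $ j) \<le> vec_norm2 v"
        unfolding vec_norm2_eq by (rule member_le_L2_set) (use that v in auto)
      then show ?thesis using v by simp
    qed
    have "vec_norm2 (A *\<^sub>v v) \<le> (\<Sum>i<N. cmod ((A *\<^sub>v v) $ i))"
      unfolding vec_norm2_eq using assms by (intro L2_set_le_sum[THEN order_trans]) auto
    also have "\<dots> \<le> (\<Sum>i<N. \<Sum>j<N. cmod (A $$ (i, j)))"
    proof (intro sum_mono)
      fix i assume "i \<in> {..<N}"
      then have "cmod ((A *\<^sub>v v) $ i) = cmod (\<Sum>j<N. A $$ (i, j) * v $ j)"
        using assms v by (auto simp: scalar_prod_def atLeast0LessThan)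
      also have "\<dots> \<le> (\<Sum>j<N. cmod (A $$ (i, j)))"
        by (intro norm_sum[THEN order_trans] sum_mono)
          (simp add: norm_mult mult_left_le le1)
      finally show "cmod ((A *\<^sub>v v) $ i) \<le> (\<Sum>j<N. cmod (A $$ (i, j)))" .
    qed
    finally show ?thesis .
  qed
  then have "bdd_above ((\<lambda>v. vec_norm2 (A *\<^sub>v v)) ` ?V)"
    by (intro bdd_aboveI2)
  \<comment> \<open>The zero vector is a witness for every \<open>N\<close>, including
    \<open>N = 0\<close>.\<close>
  moreover have "0\<^sub>v N \<in> ?V" by (simp add: vec_norm2_eq L2_set_def)
  then have "?V \<noteq> {}" by blast
  ultimately show ?thesis
    unfolding op_norm_def by (simp add: cSUP_le_iff) blast
qed

text \<open>\<open>mat_adjoint U\<close> maps the unit ball into itself and the outer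
  \<open>U\<close> preserves norms, so the pointwise bound for \<open>A\<close> carries
  over.\<close>

lemma op_norm_conj_mat_le:
  assumes U: "U \<in> unitary_group N" and A: "A \<in> carrier_mat N N" and le: "op_norm N A \<le> R"
  shows "op_norm N (conj_mat U A) \<le> R"
proof (subst op_norm_le_iff[OF conj_mat_carrier[OF U A]], intro ballI impI)
  note U' = unitary_groupD(1)[OF U] mat_adjoint_unitary_group[OF U]
  fix v :: "complex Matrix.vec" assume v: "v \<in> carrier_vec N" "vec_norm2 v \<le> 1"
  have w: "mat_adjoint U *\<^sub>v v \<in> carrier_vec N" using U' v by auto
  have "conj_mat U A *\<^sub>v v = U *\<^sub>v (A *\<^sub>v (mat_adjoint U *\<^sub>v v))"
    using U' A v by (simp add: conj_mat_def assoc_mult_mat_vec[of _ N N _ N])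
  then have "vec_norm2 (conj_mat U A *\<^sub>v v) = vec_norm2 (A *\<^sub>v (mat_adjoint U *\<^sub>v v))"
    using A w by (simp add: vec_norm2_unitary[OF U])
  also have "\<dots> \<le> R"
    using le w v by (auto simp: op_norm_le_iff[OF A] vec_norm2_unitary[OF U'(2)])
  finally show "vec_norm2 (conj_mat U A *\<^sub>v v) \<le> R" .
qed

text \<open>The entry is a component of the image of a unit vector. This bound later confines an
  operator norm ball to a cube of coordinates.\<close>

lemma cmod_entry_le_op_norm:
  assumes A: "A \<in> carrier_mat N N" and "i < N" "j < N"
  shows "cmod (A $$ (i, j)) \<le> op_norm N A"
proof -
  have u: "vec_norm2 (unit_vec N j :: complex Matrix.vec) \<le> 1"
    using assms(3) by (simp add: vec_norm2_def)
  have "cmod (A $$ (i, j)) = cmod ((A *\<^sub>v unit_vec N j) $ i)"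
    using assms by simp
  also have "\<dots> \<le> vec_norm2 (A *\<^sub>v unit_vec N j)"
    unfolding vec_norm2_eq by (rule member_le_L2_set) (use assms in auto)
  also have "\<dots> \<le> op_norm N A"
    using op_norm_le_iff[OF A, of "op_norm N A"] u by auto
  finally show ?thesis .
qed

text \<open>Makes the balls symmetric under negation, as the comparison set in
  \<open>mat_translation_invariant_eqI\<close> has to be.\<close>

lemma op_norm_uminus:
  assumes A: "A \<in> carrier_mat N N"
  shows "op_norm N (- A) = op_norm N A"
proof -
  have "vec_norm2 (- A *\<^sub>v v) = vec_norm2 (A *\<^sub>v v)" if "v \<in> carrier_vec N" for v
  proof -
    have "(- A *\<^sub>v v) $ i = - ((A *\<^sub>v v) $ i)" if "i < N" for i
      using that A \<open>v \<in> carrier_vec N\<close> by simp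
    then show ?thesis
      unfolding vec_norm2_eq using A by (intro L2_set_cong) auto
  qed
  then show ?thesis unfolding op_norm_def by (intro SUP_cong) auto
qed

lemma msa_ball_ereal: "msa_ball N (ereal R) = {A \<in> msa N. op_norm N A \<le> R}"
  by (auto simp: msa_ball_def)

lemma msa_ball_uminus: "A \<in> msa_ball N R \<Longrightarrow> - A \<in> msa_ball N R"
  by (auto simp: msa_ball_def msa_uminus op_norm_uminus msa_carrier)

lemma conj_mat_msa_ball:
  "U \<in> unitary_group N \<Longrightarrow> A \<in> msa_ball N (ereal R) \<Longrightarrow> conj_mat U A \<in> msa_ball N (ereal R)"
  by (auto simp: msa_ball_ereal conj_mat_msa op_norm_conj_mat_le msa_carrier)

section \<open>Words in matrices and operators\<close>

lemma mat_word_carrier: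
  "(\<And>k. k \<in> set w \<Longrightarrow> A k \<in> carrier_mat N N) \<Longrightarrow> mat_word N A w \<in> carrier_mat N N"
  by (induction w) (auto simp: mat_word_def intro!: mult_carrier_mat)

lemma mat_word_conj_mat:
  assumes U: "U \<in> unitary_group N" and "\<And>k. k \<in> set w \<Longrightarrow> A k \<in> carrier_mat N N"
  shows "mat_word N (\<lambda>k. conj_mat U (A k)) w = conj_mat U (mat_word N A w)"
  using assms(2)
proof (induction w)
  case Nil
  then show ?case by (simp add: mat_word_def conj_mat_one[OF U])
next
  case (Cons k w)
  then show ?case
    using mat_word_carrier[of w A N] by (simp add: mat_word_def conj_mat_mult[OF U])
qed

lemma mat_word_cong: "(\<And>k. k \<in> set w \<Longrightarrow> A k = B k) \<Longrightarrow> mat_word N A w = mat_word N B w"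
  by (induction w) (auto simp: mat_word_def)

text \<open>With \<open>f = Pair i\<close>, this and its operator counterpart turn a word in the
  letters of the block \<open>i\<close> into a word in the joint tuple.\<close>

lemma mat_word_map: "mat_word N A (map f w) = mat_word N (\<lambda>k. A (f k)) w"
  by (simp add: mat_word_def foldr_map comp_def)

lemma op_word_map: "op_word X (map f w) = op_word (\<lambda>k. X (f k)) w"
  by (simp add: op_word_def foldr_map comp_def)

section \<open>Borel structure on matrices\<close>

lemma space_mat_borel [simp]: "space (mat_borel N S) = S"
  by (simp add: mat_borel_def)

lemma measurable_mat_entry:
  assumes "i < N" "j < N"
  shows "(\<lambda>A. A $$ (i, j)) \<in> borel_measurable (mat_borel N S)"
proof -
  have "(\<lambda>x::nat \<times> nat \<Rightarrow> complex. x (i, j)) \<in> borel_measurable borel"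
    by (intro borel_measurable_continuous_onI continuous_on_product_coordinates)
  from measurable_compose[OF measurable_vimage_algebra1 this, of "mat_entries N" S]
  show ?thesis using assms by (simp add: mat_borel_def mat_entries_def)
qed

text \<open>The \<sigma>-algebra is pulled back along \<open>mat_entries\<close>, and a map into the
  function space is Borel measurable as soon as its coordinates are. Coordinates outside the index
  square are constantly 0, so only the entries remain to be checked.\<close>

lemma measurable_mat_borel_iff:
  "f \<in> M \<rightarrow>\<^sub>M mat_borel N S \<longleftrightarrow>
    f \<in> space M \<rightarrow> S \<and> (\<forall>i<N. \<forall>j<N. (\<lambda>x. f x $$ (i, j)) \<in> borel_measurable M)"
proof safe
  assume f: "f \<in> M \<rightarrow>\<^sub>M mat_borel N S"
  show "f x \<in> S" if "x \<in> space M" for x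
    using measurable_space[OF f that] by simp
  show "(\<lambda>x. f x $$ (i, j)) \<in> borel_measurable M" if "i < N" "j < N" for i j
    using measurable_compose[OF f measurable_mat_entry[OF that]] .
next
  assume f: "f \<in> space M \<rightarrow> S" "\<forall>i<N. \<forall>j<N. (\<lambda>x. f x $$ (i, j)) \<in> borel_measurable M"
  have "(\<lambda>x. mat_entries N (f x) p) \<in> borel_measurable M" for p
    using f(2) by (cases p; cases "p \<in> {..<N} \<times> {..<N}") (auto simp: mat_entries_def)
  then show "f \<in> M \<rightarrow>\<^sub>M mat_borel N S"
    unfolding mat_borel_def
    by (intro measurable_vimage_algebra2[OF f(1)] measurable_coordinatewise_then_product)
qed

lemma measurable_mat_borel_mono:
  "f \<in> M \<rightarrow>\<^sub>M mat_borel N S \<Longrightarrow> S \<subseteq> T \<Longrightarrow> f \<in> M \<rightarrow>\<^sub>M mat_borel N T"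
  unfolding measurable_mat_borel_iff by auto

lemma measurable_mat_borel_mult:
  assumes "f \<in> M \<rightarrow>\<^sub>M mat_borel N (carrier_mat N N)" "g \<in> M \<rightarrow>\<^sub>M mat_borel N (carrier_mat N N)"
  shows "(\<lambda>x. f x * g x) \<in> M \<rightarrow>\<^sub>M mat_borel N (carrier_mat N N)"
proof -
  have fg: "f x \<in> carrier_mat N N" "g x \<in> carrier_mat N N" if "x \<in> space M" for x
    using measurable_space[OF assms(1) that] measurable_space[OF assms(2) that] by auto
  have "(\<lambda>x. (f x * g x) $$ (i, j)) \<in> borel_measurable M" if "i < N" "j < N" for i j
  proof -
    have "(f x * g x) $$ (i, j) = (\<Sum>k<N. f x $$ (i, k) * g x $$ (k, j))" if "x \<in> space M" for x
      using fg[OF that] \<open>i < N\<close> \<open>j < N\<close> by (auto simp: scalar_prod_def atLeast0LessThan)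
    moreover have "(\<lambda>x. \<Sum>k<N. f x $$ (i, k) * g x $$ (k, j)) \<in> borel_measurable M"
      using assms that by (intro borel_measurable_sum borel_measurable_times)
        (auto simp: measurable_mat_borel_iff)
    ultimately show ?thesis by (simp cong: measurable_cong)
  qed
  then show ?thesis using fg by (auto simp: measurable_mat_borel_iff intro!: mult_carrier_mat)
qed

lemma measurable_mat_borel_adjoint:
  assumes "f \<in> M \<rightarrow>\<^sub>M mat_borel N (carrier_mat N N)"
  shows "(\<lambda>x. mat_adjoint (f x)) \<in> M \<rightarrow>\<^sub>M mat_borel N (carrier_mat N N)"
proof -
  have f: "f x \<in> carrier_mat N N" if "x \<in> space M" for x
    using measurable_space[OF assms that] by auto
  have "(\<lambda>x. mat_adjoint (f x) $$ (i, j)) \<in> borel_measurable M" if "i < N" "j < N" for i j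
  proof -
    have "mat_adjoint (f x) $$ (i, j) = cnj (f x $$ (j, i))" if "x \<in> space M" for x
      using f[OF that] \<open>i < N\<close> \<open>j < N\<close> by auto
    moreover have "(\<lambda>x. cnj (f x $$ (j, i))) \<in> borel_measurable M"
      using assms that by (intro measurable_compose[of _ M borel cnj borel]
          borel_measurable_continuous_onI continuous_intros) (auto simp: measurable_mat_borel_iff)
    ultimately show ?thesis by (simp cong: measurable_cong)
  qed
  then show ?thesis using f by (auto simp: measurable_mat_borel_iff)
qed

lemma measurable_mat_borel_add:
  assumes "f \<in> M \<rightarrow>\<^sub>M mat_borel N (msa N)" "g \<in> M \<rightarrow>\<^sub>M mat_borel N (msa N)"
  shows "(\<lambda>x. f x + g x) \<in> M \<rightarrow>\<^sub>M mat_borel N (msa N)"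
proof -
  have fg: "f x \<in> msa N" "g x \<in> msa N" if "x \<in> space M" for x
    using measurable_space[OF assms(1) that] measurable_space[OF assms(2) that] by auto
  have "(\<lambda>x. (f x + g x) $$ (i, j)) \<in> borel_measurable M" if "i < N" "j < N" for i j
  proof -
    have "(f x + g x) $$ (i, j) = f x $$ (i, j) + g x $$ (i, j)" if "x \<in> space M" for x
      using fg[OF that, THEN msa_carrier] \<open>i < N\<close> \<open>j < N\<close> by auto
    moreover have "(\<lambda>x. f x $$ (i, j) + g x $$ (i, j)) \<in> borel_measurable M"
      using assms that by (intro borel_measurable_add) (auto simp: measurable_mat_borel_iff)
    ultimately show ?thesis by (simp cong: measurable_cong)
  qed
  then show ?thesis using fg by (auto simp: measurable_mat_borel_iff msa_add)
qed

lemma measurable_mat_borel_minus: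
  assumes "f \<in> M \<rightarrow>\<^sub>M mat_borel N (msa N)" "g \<in> M \<rightarrow>\<^sub>M mat_borel N (msa N)"
  shows "(\<lambda>x. f x - g x) \<in> M \<rightarrow>\<^sub>M mat_borel N (msa N)"
proof -
  have fg: "f x \<in> msa N" "g x \<in> msa N" if "x \<in> space M" for x
    using measurable_space[OF assms(1) that] measurable_space[OF assms(2) that] by auto
  have "(\<lambda>x. (f x - g x) $$ (i, j)) \<in> borel_measurable M" if "i < N" "j < N" for i j
  proof -
    have "(f x - g x) $$ (i, j) = f x $$ (i, j) - g x $$ (i, j)" if "x \<in> space M" for x
      using fg[OF that, THEN msa_carrier] \<open>i < N\<close> \<open>j < N\<close> by auto
    moreover have "(\<lambda>x. f x $$ (i, j) - g x $$ (i, j)) \<in> borel_measurable M"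
      using assms that by (intro borel_measurable_diff) (auto simp: measurable_mat_borel_iff)
    ultimately show ?thesis by (simp cong: measurable_cong)
  qed
  then show ?thesis using fg by (auto simp: measurable_mat_borel_iff msa_minus)
qed

text \<open>The partial products need not be self-adjoint, so measurability is shown in
  \<open>carrier_mat N N\<close>; the values are put back into \<open>msa N\<close> at the
  end.\<close>

lemma measurable_mat_borel_conj_mat:
  assumes U: "U \<in> M \<rightarrow>\<^sub>M mat_borel N (unitary_group N)" and A: "A \<in> M \<rightarrow>\<^sub>M mat_borel N (msa N)"
  shows "(\<lambda>x. conj_mat (U x) (A x)) \<in> M \<rightarrow>\<^sub>M mat_borel N (msa N)"
proof -
  have "unitary_group N \<subseteq> carrier_mat N N" by (auto simp: unitary_group_def)
  with U have U': "U \<in> M \<rightarrow>\<^sub>M mat_borel N (carrier_mat N N)" by (rule measurable_mat_borel_mono)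
  have A': "A \<in> M \<rightarrow>\<^sub>M mat_borel N (carrier_mat N N)"
    by (rule measurable_mat_borel_mono[OF A msa_subset_carrier])
  have "(\<lambda>x. conj_mat (U x) (A x)) \<in> M \<rightarrow>\<^sub>M mat_borel N (carrier_mat N N)"
    unfolding conj_mat_def using U' A'
    by (intro measurable_mat_borel_mult measurable_mat_borel_adjoint)
  then show ?thesis
    using measurable_space[OF U] measurable_space[OF A]
    by (auto simp: measurable_mat_borel_iff intro: conj_mat_msa)
qed

lemma measurable_ntrace:
  assumes "f \<in> M \<rightarrow>\<^sub>M mat_borel N (carrier_mat N N)"
  shows "(\<lambda>x. ntrace N (f x)) \<in> borel_measurable M"
  unfolding ntrace_def using assms
  by (intro borel_measurable_divide borel_measurable_sum) (auto simp: measurable_mat_borel_iff)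

lemma measurable_mat_word:
  assumes "set w \<subseteq> I"
  shows "(\<lambda>A. mat_word N A w) \<in> (\<Pi>\<^sub>M i\<in>I. mat_borel N (msa N)) \<rightarrow>\<^sub>M mat_borel N (carrier_mat N N)"
  using assms
proof (induction w)
  case Nil
  then show ?case by (auto simp: mat_word_def intro: measurable_const)
next
  case (Cons k w)
  have "(\<lambda>A. A k) \<in> (\<Pi>\<^sub>M i\<in>I. mat_borel N (msa N)) \<rightarrow>\<^sub>M mat_borel N (carrier_mat N N)"
    using Cons.prems
    by (intro measurable_mat_borel_mono[OF _ msa_subset_carrier]) (simp add: measurable_component_singleton)
  with Cons show ?case
    unfolding mat_word_def by (auto intro: measurable_mat_borel_mult)
qed

section \<open>Measurability and invariance of microstate sets\<close>

text \<open>The norm bound is an intersection of conditions over all vectors of the unit ball, in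
  general uncountably many. Each condition is closed in the entries of \<open>A\<close>, hence so is
  the intersection, and a closed set is Borel. The function \<open>g v\<close> expresses
  \<open>vec_norm2 (A *\<^sub>v v)\<close> through those entries.\<close>

lemma msa_ball_measurable: "msa_ball N (ereal R) \<in> sets (mat_borel N (msa N))"
proof -
  define V where "V = {v \<in> carrier_vec N. vec_norm2 v \<le> 1}"
  define g where "g v x = L2_set (\<lambda>i. cmod (\<Sum>j<N. x (i, j) * vec_index v j)) {..<N}"
    for v and x :: "nat \<times> nat \<Rightarrow> complex"
  have eq: "vec_norm2 (A *\<^sub>v v) = g v (mat_entries N A)"
    if "v \<in> V" "A \<in> carrier_mat N N" for v A
    unfolding vec_norm2_eq g_def using that
    by (intro L2_set_cong) (auto simp: V_def mat_entries_def scalar_prod_def atLeast0LessThan)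
  have "closed (\<Inter>v\<in>V. {x. g v x \<le> R})"
    unfolding g_def L2_set_def
    by (intro closed_INT ballI closed_Collect_le continuous_intros continuous_on_product_coordinates)
  then have "(\<Inter>v\<in>V. {x. g v x \<le> R}) \<in> sets borel" by (rule borel_closed)
  then have "mat_entries N -` (\<Inter>v\<in>V. {x. g v x \<le> R}) \<inter> msa N \<in> sets (mat_borel N (msa N))"
    unfolding mat_borel_def by (rule in_vimage_algebra)
  also have "mat_entries N -` (\<Inter>v\<in>V. {x. g v x \<le> R}) \<inter> msa N = msa_ball N (ereal R)"
    by (auto simp: msa_ball_ereal op_norm_le_iff[OF msa_carrier] eq[OF _ msa_carrier, symmetric])
      (auto simp: V_def)
  finally show ?thesis .
qed

text \<open>Over a finite alphabet only finitely many words have length at most \<open>m\<close>, so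
  finitely many moment conditions are intersected with a product of balls.\<close>

lemma microstates_measurable:
  assumes "finite I"
  shows "microstates \<tau> I X (ereal R) N m \<delta> \<in> sets (\<Pi>\<^sub>M i\<in>I. mat_borel N (msa N))"
proof -
  define W where "W = {w. set w \<subseteq> I \<and> length w \<le> m \<and> 1 \<le> length w}"
  have "W \<subseteq> {w. set w \<subseteq> I \<and> length w \<le> m}" by (auto simp: W_def)
  then have [simp]: "finite W"
    using finite_lists_length_le[OF assms] by (rule finite_subset)
  let ?P = "\<Pi>\<^sub>M i\<in>I. mat_borel N (msa N)"
  let ?B = "\<lambda>w. {A \<in> space ?P. cmod (ntrace N (mat_word N A w) - \<tau> (op_word X w)) < \<delta>}"
  have "?B w \<in> sets ?P" if "w \<in> W" for w
  proof -
    have "(\<lambda>A. ntrace N (mat_word N A w)) \<in> borel_measurable ?P"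
      using that by (intro measurable_ntrace measurable_mat_word) (auto simp: W_def)
    then show ?thesis by measurable
  qed
  then have "{A \<in> space ?P. \<forall>w\<in>W. cmod (ntrace N (mat_word N A w) - \<tau> (op_word X w)) < \<delta>} \<in> sets ?P"
    by (intro sets.sets_Collect_finite_All) auto
  moreover have "Pi\<^sub>E I (\<lambda>_. msa_ball N (ereal R)) \<in> sets ?P"
    using assms by (intro sets_PiM_I_finite) (auto simp: msa_ball_measurable)
  ultimately have "Pi\<^sub>E I (\<lambda>_. msa_ball N (ereal R)) \<inter>
    {A \<in> space ?P. \<forall>w\<in>W. cmod (ntrace N (mat_word N A w) - \<tau> (op_word X w)) < \<delta>} \<in> sets ?P"
    by (rule sets.Int[rotated])
  also have "Pi\<^sub>E I (\<lambda>_. msa_ball N (ereal R)) \<inter>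
    {A \<in> space ?P. \<forall>w\<in>W. cmod (ntrace N (mat_word N A w) - \<tau> (op_word X w)) < \<delta>} =
    microstates \<tau> I X (ereal R) N m \<delta>"
    by (auto simp: microstates_def W_def space_PiM PiE_iff msa_ball_def extensional_def)
  finally show ?thesis .
qed

lemma microstates_mono:
  "m' \<le> m \<Longrightarrow> \<delta> \<le> \<delta>' \<Longrightarrow> microstates \<tau> I X R N m \<delta> \<subseteq> microstates \<tau> I X R N m' \<delta>'"
  unfolding microstates_def by fastforce

text \<open>One unitary matrix conjugates all members of the tuple, so every word is conjugated as a
  whole and keeps its trace; the balls are invariant too.\<close>

lemma microstates_conj_mat:
  assumes U: "U \<in> unitary_group N" and A: "A \<in> microstates \<tau> I X (ereal R) N m \<delta>"
  shows "(\<lambda>i\<in>I. conj_mat U (A i)) \<in> microstates \<tau> I X (ereal R) N m \<delta>"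
proof -
  have ball: "A i \<in> msa_ball N (ereal R)" if "i \<in> I" for i
    using A that by (auto simp: microstates_def)
  then have carrier: "A i \<in> carrier_mat N N" if "i \<in> I" for i
    using that by (auto simp: msa_ball_def msa_carrier)
  have "ntrace N (mat_word N (\<lambda>i\<in>I. conj_mat U (A i)) w) = ntrace N (mat_word N A w)"
    if "set w \<subseteq> I" for w
  proof -
    have "mat_word N (\<lambda>i\<in>I. conj_mat U (A i)) w = mat_word N (\<lambda>i. conj_mat U (A i)) w"
      using that by (intro mat_word_cong) auto
    also have "\<dots> = conj_mat U (mat_word N A w)"
      using that carrier by (intro mat_word_conj_mat[OF U]) auto
    finally show ?thesis
      using that carrier by (auto intro: ntrace_conj_mat[OF U] mat_word_carrier)
  qed
  with A show ?thesis
    by (auto simp: microstates_def ball conj_mat_msa_ball[OF U])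
qed

text \<open>The direction from left to right conjugates back by \<open>mat_adjoint U\<close>; since
  \<open>A\<close> is extensional, the result equals \<open>A\<close> outside \<open>I\<close> as
  well.\<close>

lemma microstates_conj_mat_iff:
  assumes U: "U \<in> unitary_group N" and A: "A \<in> I \<rightarrow>\<^sub>E msa N"
  shows "(\<lambda>i\<in>I. conj_mat U (A i)) \<in> microstates \<tau> I X (ereal R) N m \<delta> \<longleftrightarrow>
    A \<in> microstates \<tau> I X (ereal R) N m \<delta>"
proof
  assume "(\<lambda>i\<in>I. conj_mat U (A i)) \<in> microstates \<tau> I X (ereal R) N m \<delta>"
  from microstates_conj_mat[OF mat_adjoint_unitary_group[OF U] this]
  have "(\<lambda>i\<in>I. conj_mat (mat_adjoint U) ((\<lambda>i\<in>I. conj_mat U (A i)) i))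
    \<in> microstates \<tau> I X (ereal R) N m \<delta>" .
  also have "(\<lambda>i\<in>I. conj_mat (mat_adjoint U) ((\<lambda>i\<in>I. conj_mat U (A i)) i)) = A"
    using A by (intro extensionalityI[of _ I])
      (auto simp: conj_mat_adjoint_cancel[OF U] msa_carrier PiE_iff)
  finally show "A \<in> microstates \<tau> I X (ereal R) N m \<delta>" .
qed (rule microstates_conj_mat[OF U])

text \<open>Words in the block \<open>i\<close> alone are particular joint words, so a joint
  microstate meets all moment conditions of that block.\<close>

lemma microstates_reindex:
  assumes A: "A \<in> microstates \<tau> J (\<lambda>(i, j). X i j) R N m \<delta>" and "\<And>j. j \<in> K \<Longrightarrow> (i, j) \<in> J"
  shows "(\<lambda>j\<in>K. A (i, j)) \<in> microstates \<tau> K (X i) R N m \<delta>"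
proof -
  have "cmod (ntrace N (mat_word N (\<lambda>j\<in>K. A (i, j)) w) - \<tau> (op_word (X i) w)) < \<delta>"
    if w: "set w \<subseteq> K" "1 \<le> length w" "length w \<le> m" for w
  proof -
    have "mat_word N (\<lambda>j\<in>K. A (i, j)) w = mat_word N A (map (Pair i) w)"
      unfolding mat_word_map using w by (intro mat_word_cong) auto
    moreover have "op_word (X i) w = op_word (\<lambda>(i, j). X i j) (map (Pair i) w)"
      by (simp add: op_word_map)
    moreover have "set (map (Pair i) w) \<subseteq> J" using w assms(2) by auto
    ultimately show ?thesis using A w by (simp add: microstates_def)
  qed
  with A assms(2) show ?thesis by (auto simp: microstates_def)
qed

section \<open>Lebesgue measure on self-adjoint matrices\<close>

text \<open>The product measure is determined by its values on rectangles, and the preimage of a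
  rectangle is the rectangle of the preimages. It serves both for translations of coordinates and
  for conjugation of the blocks.\<close>

lemma (in product_sigma_finite) distr_PiM_measure_preserving:
  assumes I: "finite I" and f: "\<And>i. i \<in> I \<Longrightarrow> f i \<in> M i \<rightarrow>\<^sub>M M i"
    and distr: "\<And>i. i \<in> I \<Longrightarrow> distr (M i) (M i) (f i) = M i"
  shows "distr (Pi\<^sub>M I M) (Pi\<^sub>M I M) (\<lambda>x. \<lambda>i\<in>I. f i (x i)) = Pi\<^sub>M I M"
proof (rule PiM_eqI[OF I])
  fix A assume A: "\<And>i. i \<in> I \<Longrightarrow> A i \<in> sets (M i)"
  have "(\<lambda>x. \<lambda>i\<in>I. f i (x i)) -` Pi\<^sub>E I A \<inter> space (Pi\<^sub>M I M) = (\<Pi>\<^sub>E i\<in>I. f i -` A i \<inter> space (M i))"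
    by (auto simp: space_PiM PiE_iff)
  moreover have "(\<lambda>x. \<lambda>i\<in>I. f i (x i)) \<in> Pi\<^sub>M I M \<rightarrow>\<^sub>M Pi\<^sub>M I M"
    by (intro measurable_restrict measurable_compose[OF _ f] measurable_component_singleton)
  ultimately have "emeasure (distr (Pi\<^sub>M I M) (Pi\<^sub>M I M) (\<lambda>x. \<lambda>i\<in>I. f i (x i))) (Pi\<^sub>E I A) =
    emeasure (Pi\<^sub>M I M) (\<Pi>\<^sub>E i\<in>I. f i -` A i \<inter> space (M i))"
    using A I by (simp add: emeasure_distr sets_PiM_I_finite)
  also have "\<dots> = (\<Prod>i\<in>I. emeasure (M i) (f i -` A i \<inter> space (M i)))"
    using f A by (intro emeasure_PiM[OF I]) auto
  also have "\<dots> = (\<Prod>i\<in>I. emeasure (M i) (A i))"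
    using f A distr by (intro prod.cong refl) (metis emeasure_distr)
  finally show "emeasure (distr (Pi\<^sub>M I M) (Pi\<^sub>M I M) (\<lambda>x. \<lambda>i\<in>I. f i (x i))) (Pi\<^sub>E I A) =
    (\<Prod>i\<in>I. emeasure (M i) (A i))" .
qed simp

section \<open>Coordinates on self-adjoint matrices\<close>

interpretation lborel_product: product_sigma_finite "\<lambda>_::nat \<times> nat. lborel :: real measure"
  by standard

abbreviation coord_measure :: "nat \<Rightarrow> (nat \<times> nat \<Rightarrow> real) measure" where
  "coord_measure N \<equiv> Pi\<^sub>M ({..<N} \<times> {..<N}) (\<lambda>_. lborel)"

lemma msa_of_coords_carrier: "msa_of_coords N x \<in> carrier_mat N N"
  by (simp add: msa_of_coords_def)

lemma msa_of_coords_index: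
  assumes "i < N" "j < N"
  shows "msa_of_coords N x $$ (i, j) =
    (if i = j then complex_of_real (x (i, i))
     else if i < j then Complex (x (i, j) / sqrt 2) (x (j, i) / sqrt 2)
     else Complex (x (j, i) / sqrt 2) (- (x (i, j) / sqrt 2)))"
  using assms by (simp add: msa_of_coords_def)

lemma msa_of_coords_msa: "msa_of_coords N x \<in> msa N"
  by (auto simp: msa_iff msa_of_coords_carrier msa_of_coords_index complex_eq_iff)

lemma msa_of_coords_measurable: "msa_of_coords N \<in> coord_measure N \<rightarrow>\<^sub>M mat_borel N (msa N)"
proof -
  have "(\<lambda>x. msa_of_coords N x $$ (i, j)) \<in> borel_measurable (coord_measure N)"
    if ij: "i < N" "j < N" for i j
  proof -
    have x: "(\<lambda>x. x (k, l)) \<in> borel_measurable (coord_measure N)" if "k < N" "l < N" for k l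
      using that measurable_component_singleton[of "(k, l)" "{..<N} \<times> {..<N}" "\<lambda>_. lborel"] by simp
    show ?thesis
      using x[OF ij] x[OF ij(2,1)] x[OF ij(1,1)] unfolding msa_of_coords_index[OF ij] Complex_eq
      by (cases "i = j"; cases "i < j") simp_all
  qed
  then show ?thesis by (auto simp: measurable_mat_borel_iff msa_of_coords_msa)
qed

text \<open>Points of \<open>coord_measure N\<close> are extensional, so a translation there must be
  restricted to the index square; outside it the coordinates are never read.\<close>

lemma msa_of_coords_restrict:
  "msa_of_coords N (\<lambda>p\<in>{..<N} \<times> {..<N}. x p) = msa_of_coords N x"
  by (auto simp: msa_of_coords_def)

lemma msa_of_coords_add: "msa_of_coords N (\<lambda>p. x p + y p) = msa_of_coords N x + msa_of_coords N y"
  by (auto simp: mat_eq_iff msa_of_coords_def complex_eq_iff add_divide_distrib)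

lemma msa_of_coords_surj:
  assumes B: "B \<in> msa N"
  obtains y where "msa_of_coords N y = B"
proof
  \<comment> \<open>These coordinates invert \<open>msa_of_coords\<close>: above the diagonal they
    hold the real part of the entry, below it the imaginary part of the transposed entry, both
    scaled by \<open>sqrt 2\<close>.\<close>
  let ?y = "\<lambda>(i, j). if i = j then Re (B $$ (i, i))
    else if i < j then sqrt 2 * Re (B $$ (i, j)) else sqrt 2 * Im (B $$ (j, i))"
  have "B $$ (i, j) = cnj (B $$ (j, i))" if "i < N" "j < N" for i j
    using B that by (simp add: msa_iff)
  then have sym: "Re (B $$ (i, j)) = Re (B $$ (j, i))" "Im (B $$ (i, j)) = - Im (B $$ (j, i))"
    if "i < N" "j < N" for i j
    using that by (metis cnj.simps)+
  have "msa_of_coords N ?y $$ (i, j) = B $$ (i, j)" if ij: "i < N" "j < N" for i j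
    using sym[OF ij] sym(2)[OF ij(1) ij(1)]
    by (cases i j rule: linorder_cases) (simp_all add: msa_of_coords_index ij complex_eq_iff)
  then show "msa_of_coords N ?y = B"
    using msa_carrier[OF B] msa_of_coords_carrier[of N ?y] by (intro eq_matI) auto
qed

lemma sets_Lebesgue_msa [simp, measurable_cong]: "sets (Lebesgue_msa N) = sets (mat_borel N (msa N))"
  by (simp add: Lebesgue_msa_def)

lemma space_Lebesgue_msa [simp]: "space (Lebesgue_msa N) = msa N"
  by (simp add: Lebesgue_msa_def)

lemma distr_coord_measure_translation:
  "distr (coord_measure N) (coord_measure N) (\<lambda>x. \<lambda>p\<in>{..<N} \<times> {..<N}. x p + y p) = coord_measure N"
proof -
  have "distr lborel lborel (\<lambda>t. t + c) = lborel" for c :: real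
  proof -
    have "distr lborel lborel (\<lambda>t. t + c) = distr lborel borel ((+) c)"
      by (intro distr_cong) (auto simp: add.commute)
    then show ?thesis by (simp add: lborel_distr_plus)
  qed
  then show ?thesis
    by (intro lborel_product.distr_PiM_measure_preserving) auto
qed

section \<open>Translation invariance, and the measure of balls\<close>

lemma measurable_mat_translation:
  "B \<in> msa N \<Longrightarrow> (\<lambda>A. A + B) \<in> mat_borel N (msa N) \<rightarrow>\<^sub>M mat_borel N (msa N)"
  by (intro measurable_mat_borel_add measurable_ident) auto

definition mat_translation_invariant :: "nat \<Rightarrow> complex mat measure \<Rightarrow> bool" where
  "mat_translation_invariant N \<mu> \<longleftrightarrow> (\<forall>B\<in>msa N. distr \<mu> \<mu> (\<lambda>A. A + B) = \<mu>)"

text \<open>The coordinate map is additive and onto, so translation by \<open>B\<close> comes from a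
  translation of the coordinates, which preserves \<open>coord_measure N\<close>.\<close>

lemma Lebesgue_msa_translation_invariant: "mat_translation_invariant N (Lebesgue_msa N)"
  unfolding mat_translation_invariant_def
proof
  fix B assume B: "B \<in> msa N"
  then obtain y where y: "msa_of_coords N y = B" by (rule msa_of_coords_surj)
  let ?L = "coord_measure N" and ?f = "msa_of_coords N" and ?b = "mat_borel N (msa N)"
  let ?t = "\<lambda>x. \<lambda>p\<in>{..<N} \<times> {..<N}. x p + y p"
  have t: "?t \<in> ?L \<rightarrow>\<^sub>M ?L"
    by (intro measurable_restrict) measurable
  have "distr (Lebesgue_msa N) (Lebesgue_msa N) (\<lambda>A. A + B) = distr (distr ?L ?b ?f) ?b (\<lambda>A. A + B)"
    by (intro distr_cong) (auto simp: Lebesgue_msa_def)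
  also have "\<dots> = distr ?L ?b ((\<lambda>A. A + B) \<circ> ?f)"
    by (intro distr_distr measurable_mat_translation B msa_of_coords_measurable)
  also have "(\<lambda>A. A + B) \<circ> ?f = ?f \<circ> ?t"
    by (simp add: fun_eq_iff msa_of_coords_restrict msa_of_coords_add y)
  also have "distr ?L ?b (?f \<circ> ?t) = distr (distr ?L ?L ?t) ?b ?f"
    by (intro distr_distr[symmetric] t msa_of_coords_measurable)
  also have "\<dots> = Lebesgue_msa N"
    by (simp add: distr_coord_measure_translation Lebesgue_msa_def)
  finally show "distr (Lebesgue_msa N) (Lebesgue_msa N) (\<lambda>A. A + B) = Lebesgue_msa N" .
qed

text \<open>In coordinates a ball lies in a cube: entries are bounded by the operator norm, and a
  coordinate is at most \<open>sqrt 2\<close> times the modulus of its entry.\<close>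

lemma emeasure_msa_ball_finite: "emeasure (Lebesgue_msa N) (msa_ball N (ereal R)) < \<infinity>"
proof -
  let ?L = "coord_measure N" and ?K = "{..<N} \<times> {..<N}" and ?c = "sqrt 2 * R"
  have "x p \<in> {- ?c .. ?c}" if x: "msa_of_coords N x \<in> msa_ball N (ereal R)" and p: "p \<in> ?K" for x p
  proof -
    obtain i j where ij: "p = (i, j)" "i < N" "j < N" using p by auto
    have "cmod (msa_of_coords N x $$ q) \<le> R" if "q \<in> ?K" for q
      using x that cmod_entry_le_op_norm[OF msa_of_coords_carrier[of N x]]
      by (force simp: msa_ball_ereal)
    then have le: "cmod (msa_of_coords N x $$ (i, j)) \<le> R" "cmod (msa_of_coords N x $$ (j, i)) \<le> R"
      using ij by auto
    then have "0 \<le> R" using norm_ge_zero order_trans by blast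
    have "\<bar>x p\<bar> / sqrt 2 \<le> R"
    proof (cases "i < j \<or> j < i")
      case True
      then show ?thesis
      proof
        assume "i < j"
        then have "\<bar>x p\<bar> / sqrt 2 = \<bar>Re (msa_of_coords N x $$ (i, j))\<bar>"
          using ij by (simp add: msa_of_coords_index)
        then show ?thesis using le(1) abs_Re_le_cmod order_trans by metis
      next
        assume "j < i"
        then have "\<bar>x p\<bar> / sqrt 2 = \<bar>Im (msa_of_coords N x $$ (i, j))\<bar>"
          using ij by (simp add: msa_of_coords_index)
        then show ?thesis using le(1) abs_Im_le_cmod order_trans by metis
      qed
    next
      case False
      then have "i = j" by auto
      then have "\<bar>x p\<bar> \<le> R" using ij le(1) by (simp add: msa_of_coords_index)
      \<comment> \<open>Diagonal coordinates carry no factor \<open>sqrt 2\<close>; the weaker bound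
        is taken so that one cube serves for all coordinates.\<close>
      moreover have "\<bar>x p\<bar> / sqrt 2 \<le> \<bar>x p\<bar>"
        by (simp add: divide_le_eq mult_left_le_one_le mult_le_cancel_left1)
      ultimately show ?thesis by simp
    qed
    then have "\<bar>x p\<bar> \<le> ?c" by (simp add: divide_le_eq mult.commute)
    then show ?thesis by auto
  qed
  then have sub: "msa_of_coords N -` msa_ball N (ereal R) \<inter> space ?L \<subseteq> (\<Pi>\<^sub>E p\<in>?K. {- ?c .. ?c})"
    unfolding space_PiM PiE_iff by blast
  have "emeasure (Lebesgue_msa N) (msa_ball N (ereal R)) =
    emeasure ?L (msa_of_coords N -` msa_ball N (ereal R) \<inter> space ?L)"
    unfolding Lebesgue_msa_def
    by (intro emeasure_distr msa_of_coords_measurable msa_ball_measurable)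
  also have "\<dots> \<le> emeasure ?L (\<Pi>\<^sub>E p\<in>?K. {- ?c .. ?c})"
    using sub by (intro emeasure_mono sets_PiM_I_finite) auto
  also have "\<dots> = (\<Prod>p\<in>?K. emeasure lborel {- ?c .. ?c})"
    by (intro lborel_product.emeasure_PiM) auto
  also have "\<dots> < \<infinity>"
    by (simp add: emeasure_lborel_Icc_eq power_less_top_ennreal)
  finally show ?thesis .
qed

lemma msa_eq_UN_msa_ball: "msa N = (\<Union>k. msa_ball N (ereal (real k)))"
  by (auto simp: msa_ball_ereal intro: real_arch_simple)

text \<open>The preimage of \<open>msa N\<close> is the whole coordinate space, whose measure is a
  product of infinite factors, or the empty product 1 for \<open>N = 0\<close>.\<close>

lemma emeasure_Lebesgue_msa_space: "emeasure (Lebesgue_msa N) (msa N) \<noteq> 0"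
proof -
  let ?L = "coord_measure N" and ?K = "{..<N} \<times> {..<N}"
  have "emeasure (Lebesgue_msa N) (msa N) = emeasure ?L (space ?L)"
    using emeasure_distr[OF msa_of_coords_measurable sets.top, of N]
    by (auto simp: Lebesgue_msa_def msa_of_coords_msa intro!: arg_cong[where f="emeasure ?L"])
  also have "space ?L = (\<Pi>\<^sub>E p\<in>?K. UNIV)" by (simp add: space_PiM)
  also have "emeasure ?L (\<Pi>\<^sub>E p\<in>?K. UNIV) = (\<Prod>p\<in>?K. emeasure lborel (UNIV :: real set))"
    by (intro lborel_product.emeasure_PiM) auto
  also have "\<dots> \<noteq> 0" by (simp add: prod_zero_iff)
  finally show ?thesis .
qed

text \<open>If all balls were null sets, their countable union \<open>msa N\<close> would be one. A
  ball of positive measure is the set on which two invariant measures will be compared.\<close>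

lemma msa_ball_emeasure_nonzero:
  obtains k where "emeasure (Lebesgue_msa N) (msa_ball N (ereal (real k))) \<noteq> 0"
proof -
  have "\<exists>k. emeasure (Lebesgue_msa N) (msa_ball N (ereal (real k))) \<noteq> 0"
  proof (rule ccontr)
    assume "\<not> ?thesis"
    then have "emeasure (Lebesgue_msa N) (\<Union>k. msa_ball N (ereal (real k))) = 0"
      by (intro emeasure_UN_eq_0) (auto simp: msa_ball_measurable)
    then show False
      using emeasure_Lebesgue_msa_space by (simp flip: msa_eq_UN_msa_ball)
  qed
  then show thesis using that by blast
qed

lemma sigma_finite_msa:
  assumes "sets \<mu> = sets (mat_borel N (msa N))"
    and "\<And>k. emeasure \<mu> (msa_ball N (ereal (real k))) < \<infinity>"
  shows "sigma_finite_measure \<mu>"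
proof
  have "space \<mu> = msa N" using sets_eq_imp_space_eq[OF assms(1)] by simp
  then show "\<exists>A. countable A \<and> A \<subseteq> sets \<mu> \<and> \<Union> A = space \<mu> \<and> (\<forall>a\<in>A. emeasure \<mu> a \<noteq> \<infinity>)"
    using assms(2) by (intro exI[of _ "range (\<lambda>k. msa_ball N (ereal (real k)))"])
      (auto simp: assms(1) msa_ball_measurable less_top msa_eq_UN_msa_ball[symmetric])
qed

text \<open>
  Uniqueness of Haar measure: by Fubini and invariance, the integral of
  \<open>indicator B x * indicator E (x + y)\<close> is \<open>\<mu> B * \<nu> E\<close> in one order of integration, and
  \<open>\<mu> E * \<nu> B\<close> in the other.
\<close>

lemma mat_translation_invariant_eqI:
  assumes \<mu>: "sets \<mu> = sets (mat_borel N (msa N))" "mat_translation_invariant N \<mu>"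
      "sigma_finite_measure \<mu>"
    and \<nu>: "sets \<nu> = sets (mat_borel N (msa N))" "mat_translation_invariant N \<nu>"
      "sigma_finite_measure \<nu>"
    and B: "B \<in> sets (mat_borel N (msa N))" "\<And>A. A \<in> B \<Longrightarrow> - A \<in> B"
    and eq: "emeasure \<mu> B = emeasure \<nu> B" "emeasure \<nu> B \<noteq> 0" "emeasure \<nu> B \<noteq> \<infinity>"
  shows "\<mu> = \<nu>"
proof (rule measure_eqI)
  interpret \<mu>: sigma_finite_measure \<mu> by fact
  interpret \<nu>: sigma_finite_measure \<nu> by fact
  interpret pair_sigma_finite \<mu> \<nu> ..
  let ?b = "mat_borel N (msa N)"
  note [measurable_cong] = \<mu>(1) \<nu>(1)
  have space: "space \<mu> = msa N" "space \<nu> = msa N"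
    using sets_eq_imp_space_eq[OF \<mu>(1)] sets_eq_imp_space_eq[OF \<nu>(1)] by auto
  have meas_b: "measurable M \<mu> = measurable M ?b" "measurable M \<nu> = measurable M ?b"
    "measurable \<mu> M = measurable ?b M" "measurable \<nu> M = measurable ?b M" for M :: "complex mat measure"
    using \<mu>(1) \<nu>(1) by (auto intro!: measurable_cong_sets)
  have shift: "(\<integral>\<^sup>+x. f (x + C) \<partial>\<rho>) = (\<integral>\<^sup>+x. f x \<partial>\<rho>)"
    if "\<rho> = \<mu> \<or> \<rho> = \<nu>" "C \<in> msa N" "f \<in> borel_measurable ?b" for \<rho> C and f :: "complex mat \<Rightarrow> ennreal"
  proof -
    have [measurable]: "(\<lambda>A. A + C) \<in> \<rho> \<rightarrow>\<^sub>M \<rho>"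
      using that(1) measurable_mat_translation[OF that(2)] meas_b by auto
    have f[measurable]: "f \<in> borel_measurable \<rho>"
      using that(1,3) \<mu>(1) \<nu>(1) by (auto cong: measurable_cong_sets)
    have "(\<integral>\<^sup>+x. f x \<partial>distr \<rho> \<rho> (\<lambda>A. A + C)) = (\<integral>\<^sup>+x. f (x + C) \<partial>\<rho>)"
      by (intro nn_integral_distr) measurable
    moreover have "distr \<rho> \<rho> (\<lambda>A. A + C) = \<rho>"
      using that \<mu>(2) \<nu>(2) by (auto simp: mat_translation_invariant_def)
    ultimately show ?thesis by simp
  qed
  show "sets \<mu> = sets \<nu>" by (simp add: \<mu> \<nu>)
  fix E assume "E \<in> sets \<mu>"
  then have E: "E \<in> sets ?b" by (simp add: \<mu>)
  \<comment> \<open>Used to write \<open>x - y\<close> as the negative of a translate of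
    \<open>y\<close>, so that the invariance of \<nu> applies to the integral over
    \<open>y\<close>.\<close>
  have minus: "y + - x = - (x - y)" if "x \<in> msa N" "y \<in> msa N" for x y
    using that[THEN msa_carrier] by (auto simp: mat_eq_iff)
  have fst': "fst \<in> \<mu> \<Otimes>\<^sub>M \<nu> \<rightarrow>\<^sub>M ?b" and snd': "snd \<in> \<mu> \<Otimes>\<^sub>M \<nu> \<rightarrow>\<^sub>M ?b"
    using measurable_fst[of \<mu> \<nu>] measurable_snd[of \<mu> \<nu>] by (simp_all add: \<mu>(1) \<nu>(1) cong: measurable_cong_sets)
  have iB[measurable]: "indicator B \<in> borel_measurable ?b" and iE[measurable]: "indicator E \<in> borel_measurable ?b"
    using B E by auto
  have add: "(\<lambda>p. fst p + snd p) \<in> \<mu> \<Otimes>\<^sub>M \<nu> \<rightarrow>\<^sub>M ?b"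
    using fst' snd' by (rule measurable_mat_borel_add)
  have diff: "(\<lambda>p. fst p - snd p) \<in> \<mu> \<Otimes>\<^sub>M \<nu> \<rightarrow>\<^sub>M ?b"
    using fst' snd' by (rule measurable_mat_borel_minus)
  have m1: "(\<lambda>p. indicator B (fst p) * indicator E (fst p + snd p) :: ennreal)
      \<in> borel_measurable (\<mu> \<Otimes>\<^sub>M \<nu>)"
    by (intro borel_measurable_times_ennreal measurable_compose[OF fst' iB] measurable_compose[OF add iE])
  have m2: "(\<lambda>p. indicator B (fst p - snd p) * indicator E (fst p) :: ennreal)
      \<in> borel_measurable (\<mu> \<Otimes>\<^sub>M \<nu>)"
    by (intro borel_measurable_times_ennreal measurable_compose[OF fst' iE] measurable_compose[OF diff iB])
  have "emeasure \<mu> B * emeasure \<nu> E = (\<integral>\<^sup>+x. indicator B x * emeasure \<nu> E \<partial>\<mu>)"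
    using B by (simp add: \<mu>(1) nn_integral_multc)
  also have "\<dots> = (\<integral>\<^sup>+x. (\<integral>\<^sup>+y. indicator B x * indicator E (x + y) \<partial>\<nu>) \<partial>\<mu>)"
  proof (rule nn_integral_cong)
    fix x assume "x \<in> space \<mu>"
    then have x: "x \<in> msa N" by (simp add: space)
    have "(\<integral>\<^sup>+y. indicator B x * indicator E (x + y) \<partial>\<nu>) = (\<integral>\<^sup>+y. indicator B x * indicator E (y + x) \<partial>\<nu>)"
      using x by (intro nn_integral_cong) (simp add: space comm_add_mat[OF msa_carrier msa_carrier])
    also have "\<dots> = (\<integral>\<^sup>+y. indicator B x * indicator E y \<partial>\<nu>)"
      using x by (intro shift) auto
    also have "\<dots> = indicator B x * emeasure \<nu> E"
      using E by (simp add: nn_integral_cmult \<nu>(1))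
    finally show "indicator B x * emeasure \<nu> E = (\<integral>\<^sup>+y. indicator B x * indicator E (x + y) \<partial>\<nu>)" ..
  qed
  also have "\<dots> = (\<integral>\<^sup>+y. (\<integral>\<^sup>+x. indicator B x * indicator E (x + y) \<partial>\<mu>) \<partial>\<nu>)"
    using Fubini[OF m1] by simp
  also have "\<dots> = (\<integral>\<^sup>+y. (\<integral>\<^sup>+x. indicator B (x - y) * indicator E x \<partial>\<mu>) \<partial>\<nu>)"
  proof (rule nn_integral_cong)
    fix y assume "y \<in> space \<nu>"
    then have y: "y \<in> msa N" by (simp add: space)
    \<comment> \<open>For fixed \<open>y\<close>, translating the variable \<open>x\<close> by
      \<open>y\<close> moves the shift between the argument of \<open>B\<close> and that of
      \<open>E\<close>.\<close>
    have "(\<integral>\<^sup>+x. indicator B (x - y) * indicator E x \<partial>\<mu>) =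
      (\<integral>\<^sup>+x. indicator B (x + y - y) * indicator E (x + y) \<partial>\<mu>)"
      using y by (intro shift[symmetric] borel_measurable_times_ennreal
          measurable_compose[OF measurable_mat_borel_minus iB] iE) auto
    also have "\<dots> = (\<integral>\<^sup>+x. indicator B x * indicator E (x + y) \<partial>\<mu>)"
    proof (rule nn_integral_cong)
      fix x assume "x \<in> space \<mu>"
      then have "x + y - y = x" using y by (auto simp: space mat_eq_iff dest!: msa_carrier)
      then show "indicator B (x + y - y) * indicator E (x + y) =
        (indicator B x * indicator E (x + y) :: ennreal)" by simp
    qed
    finally show "(\<integral>\<^sup>+x. indicator B x * indicator E (x + y) \<partial>\<mu>) =
      (\<integral>\<^sup>+x. indicator B (x - y) * indicator E x \<partial>\<mu>)" ..
  qed
  also have "\<dots> = (\<integral>\<^sup>+x. (\<integral>\<^sup>+y. indicator B (x - y) * indicator E x \<partial>\<nu>) \<partial>\<mu>)"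
    using Fubini[OF m2] by simp
  also have "\<dots> = (\<integral>\<^sup>+x. emeasure \<nu> B * indicator E x \<partial>\<mu>)"
  proof (rule nn_integral_cong)
    fix x assume "x \<in> space \<mu>"
    then have x: "x \<in> msa N" by (simp add: space)
    \<comment> \<open>The symmetry of \<open>B\<close> under negation enters here:
      \<open>x - y\<close> and \<open>y + - x\<close> lie in \<open>B\<close> together.\<close>
    have "indicator B (x - y) = (indicator B (y + - x) :: ennreal)" if "y \<in> msa N" for y
    proof -
      have "- (- (x - y)) = x - y" using msa_carrier[OF x] msa_carrier[OF that] by (auto simp: mat_eq_iff)
      then have "x - y \<in> B \<longleftrightarrow> - (x - y) \<in> B" using B(2) by metis
      then show ?thesis using minus[OF x that] by (simp add: indicator_def)
    qed
    then have "(\<integral>\<^sup>+y. indicator B (x - y) * indicator E x \<partial>\<nu>) =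
      (\<integral>\<^sup>+y. indicator B (y + - x) * indicator E x \<partial>\<nu>)"
      by (intro nn_integral_cong) (simp add: space)
    also have "\<dots> = (\<integral>\<^sup>+y. indicator B y * indicator E x \<partial>\<nu>)"
      using x by (intro shift) (auto simp: msa_uminus)
    also have "\<dots> = emeasure \<nu> B * indicator E x"
      using B by (simp add: nn_integral_multc \<nu>(1))
    finally show "(\<integral>\<^sup>+y. indicator B (x - y) * indicator E x \<partial>\<nu>) = emeasure \<nu> B * indicator E x" .
  qed
  also have "\<dots> = emeasure \<nu> B * emeasure \<mu> E"
    using E by (simp add: \<mu>(1) nn_integral_cmult)
  \<comment> \<open>The measure of \<open>B\<close> is the same for \<mu> and \<nu>, finite and
    nonzero, so it cancels.\<close>
  finally show "emeasure \<mu> E = emeasure \<nu> E"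
    using eq by (simp add: ennreal_mult_cancel_left)
qed

text \<open>No Jacobian is computed. The image measure is again translation invariant and agrees
  with Lebesgue measure on balls, which conjugation maps onto themselves, so the uniqueness of the
  invariant measure applies.\<close>

lemma distr_Lebesgue_msa_conj_mat:
  assumes U: "U \<in> unitary_group N"
  shows "distr (Lebesgue_msa N) (Lebesgue_msa N) (conj_mat U) = Lebesgue_msa N"
proof -
  let ?L = "Lebesgue_msa N" and ?b = "mat_borel N (msa N)"
  let ?\<nu> = "distr ?L ?L (conj_mat U)"
  have meas: "conj_mat U \<in> ?L \<rightarrow>\<^sub>M ?L"
    using measurable_mat_borel_conj_mat[of "\<lambda>_. U" ?b N "\<lambda>A. A"] U
    by (simp cong: measurable_cong_sets)
  have ball: "emeasure ?\<nu> (msa_ball N (ereal R)) = emeasure ?L (msa_ball N (ereal R))" for R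
  proof -
    have "conj_mat U A \<in> msa_ball N (ereal R) \<longleftrightarrow> A \<in> msa_ball N (ereal R)" if "A \<in> msa N" for A
      using conj_mat_msa_ball[OF U, of A R] conj_mat_adjoint_cancel(1)[OF U msa_carrier[OF that]]
        conj_mat_msa_ball[OF mat_adjoint_unitary_group[OF U], of "conj_mat U A" R] by auto
    then have "conj_mat U -` msa_ball N (ereal R) \<inter> msa N = msa_ball N (ereal R)"
      by (auto simp: msa_ball_def)
    then show ?thesis by (simp add: emeasure_distr[OF meas] msa_ball_measurable)
  qed
  have invariant: "mat_translation_invariant N ?\<nu>"
    unfolding mat_translation_invariant_def
  proof
    fix B assume B: "B \<in> msa N"
    \<comment> \<open>Conjugation after translation by \<open>C\<close> is translation by
      \<open>B\<close> after conjugation, so invariance under \<open>B\<close> reduces to the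
      invariance of Lebesgue measure under \<open>C\<close>.\<close>
    define C where "C = conj_mat (mat_adjoint U) B"
    have C: "C \<in> msa N" "conj_mat U C = B"
      using B U by (auto simp: C_def conj_mat_msa mat_adjoint_unitary_group conj_mat_adjoint_cancel msa_carrier)
    have tr: "(\<lambda>A. A + D) \<in> ?L \<rightarrow>\<^sub>M ?L" if "D \<in> msa N" for D
      using measurable_mat_translation[OF that] by (simp cong: measurable_cong_sets)
    have "distr ?\<nu> ?\<nu> (\<lambda>A. A + B) = distr ?\<nu> ?L (\<lambda>A. A + B)"
      by (intro distr_cong) auto
    also have "\<dots> = distr ?L ?L ((\<lambda>A. A + B) \<circ> conj_mat U)"
      by (intro distr_distr tr B meas)
    also have "\<dots> = distr ?L ?L (conj_mat U \<circ> (\<lambda>A. A + C))"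
      using C by (intro distr_cong) (auto simp: conj_mat_add[OF U] msa_carrier)
    also have "\<dots> = distr (distr ?L ?L (\<lambda>A. A + C)) ?L (conj_mat U)"
      by (intro distr_distr[symmetric] tr C meas)
    also have "distr ?L ?L (\<lambda>A. A + C) = ?L"
      using Lebesgue_msa_translation_invariant C by (simp add: mat_translation_invariant_def)
    finally show "distr ?\<nu> ?\<nu> (\<lambda>A. A + B) = ?\<nu>" .
  qed
  obtain k where k: "emeasure ?L (msa_ball N (ereal (real k))) \<noteq> 0"
    by (rule msa_ball_emeasure_nonzero)
  show ?thesis
  proof (rule mat_translation_invariant_eqI)
    show "emeasure ?L (msa_ball N (ereal (real k))) \<noteq> \<infinity>"
      using emeasure_msa_ball_finite by (simp add: less_top[symmetric])
    show "sigma_finite_measure ?\<nu>" "sigma_finite_measure ?L"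
      using emeasure_msa_ball_finite by (auto intro!: sigma_finite_msa simp: ball)
    show "emeasure ?\<nu> (msa_ball N (ereal (real k))) = emeasure ?L (msa_ball N (ereal (real k)))"
      by (rule ball)
    show "mat_translation_invariant N ?\<nu>" by (rule invariant)
  qed (use k in \<open>auto simp: Lebesgue_msa_translation_invariant msa_ball_measurable msa_ball_uminus\<close>)
qed

section \<open>Products of Lebesgue measures and microstates\<close>

interpretation Lebesgue_msa: sigma_finite_measure "Lebesgue_msa N" for N
  using emeasure_msa_ball_finite by (intro sigma_finite_msa) auto

interpretation Lebesgue_product: product_sigma_finite "\<lambda>_. Lebesgue_msa N" for N
  by standard

abbreviation Lebesgue_tuple :: "nat \<Rightarrow> 'i set \<Rightarrow> ('i \<Rightarrow> complex mat) measure" where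
  "Lebesgue_tuple N I \<equiv> Pi\<^sub>M I (\<lambda>_. Lebesgue_msa N)"

lemma sets_Lebesgue_tuple: "sets (Lebesgue_tuple N I) = sets (\<Pi>\<^sub>M i\<in>I. mat_borel N (msa N))"
  by (intro sets_PiM_cong) auto

lemma space_Lebesgue_tuple: "space (Lebesgue_tuple N I) = I \<rightarrow>\<^sub>E msa N"
  by (simp add: space_PiM)

lemma emeasure_microstates_finite:
  assumes "finite I"
  shows "emeasure (Lebesgue_tuple N I) (microstates \<tau> I X (ereal R) N m \<delta>) < \<infinity>"
proof -
  have "emeasure (Lebesgue_tuple N I) (microstates \<tau> I X (ereal R) N m \<delta>) \<le>
    emeasure (Lebesgue_tuple N I) (Pi\<^sub>E I (\<lambda>_. msa_ball N (ereal R)))"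
    using assms by (intro emeasure_mono sets_PiM_I_finite) (auto simp: microstates_def msa_ball_measurable)
  also have "\<dots> = (\<Prod>i\<in>I. emeasure (Lebesgue_msa N) (msa_ball N (ereal R)))"
    using assms by (intro Lebesgue_product.emeasure_PiM) (auto simp: msa_ball_measurable)
  also have "\<dots> < \<infinity>"
    using emeasure_msa_ball_finite[of N R] by (simp add: power_less_top_ennreal)
  finally show ?thesis .
qed

text \<open>A family over pairs is a family of families. The uncurrying map \<open>?F\<close>
  carries the iterated product measure to the product over pairs, since they agree on rectangles,
  and the preimage of \<open>D\<close> under it is the plain product of the sets
  \<open>G i\<close>.\<close>

lemma emeasure_PiM_Sigma:
  fixes I :: "'i set" and K :: "'i \<Rightarrow> 'j set"
  assumes L: "sigma_finite_measure L" and I: "finite I" and K: "\<And>i. finite (K i)"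
    and G: "\<And>i. i \<in> I \<Longrightarrow> G i \<in> sets (Pi\<^sub>M (K i) (\<lambda>_. L))"
  defines "D \<equiv> {A \<in> space (Pi\<^sub>M (Sigma I K) (\<lambda>_. L)). \<forall>i\<in>I. (\<lambda>j\<in>K i. A (i, j)) \<in> G i}"
  shows "D \<in> sets (Pi\<^sub>M (Sigma I K) (\<lambda>_. L))"
    and "emeasure (Pi\<^sub>M (Sigma I K) (\<lambda>_. L)) D = (\<Prod>i\<in>I. emeasure (Pi\<^sub>M (K i) (\<lambda>_. L)) (G i))"
proof -
  interpret L: sigma_finite_measure L by fact
  interpret pair: product_sigma_finite "\<lambda>_::'i \<times> 'j. L" by standard
  interpret inner: product_sigma_finite "\<lambda>_::'j. L" by standard
  interpret outer: product_sigma_finite "\<lambda>i. Pi\<^sub>M (K i) (\<lambda>_. L)"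
    by (intro product_sigma_finite.intro inner.sigma_finite K)
  let ?S = "Sigma I K"
  let ?P = "Pi\<^sub>M ?S (\<lambda>_. L)" and ?Q = "Pi\<^sub>M I (\<lambda>i. Pi\<^sub>M (K i) (\<lambda>_. L))"
  let ?F = "\<lambda>f. \<lambda>p\<in>?S. f (fst p) (snd p)"
  have S: "finite ?S" using I K by auto
  have F: "?F \<in> ?Q \<rightarrow>\<^sub>M ?P"
  proof (rule measurable_restrict)
    fix p assume "p \<in> ?S"
    then show "(\<lambda>f. f (fst p) (snd p)) \<in> ?Q \<rightarrow>\<^sub>M L"
      by (intro measurable_compose[OF measurable_component_singleton[of "fst p" I]
            measurable_component_singleton]) auto
  qed
  have distr: "distr ?Q ?P ?F = ?P"
  proof (rule pair.PiM_eqI[OF S])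
    fix A :: "'i \<times> 'j \<Rightarrow> 'a set" assume A: "\<And>p. p \<in> ?S \<Longrightarrow> A p \<in> sets L"
    have "?F -` Pi\<^sub>E ?S A \<inter> space ?Q = (\<Pi>\<^sub>E i\<in>I. \<Pi>\<^sub>E j\<in>K i. A (i, j))"
    proof (intro subset_antisym subsetI)
      fix f assume f: "f \<in> ?F -` Pi\<^sub>E ?S A \<inter> space ?Q"
      then have "f i j \<in> A (i, j)" if "i \<in> I" "j \<in> K i" for i j
        using that by (auto simp: PiE_iff)
      moreover have "f \<in> extensional I" "\<And>i. i \<in> I \<Longrightarrow> f i \<in> extensional (K i)"
        using f by (auto simp: space_PiM PiE_iff)
      ultimately show "f \<in> (\<Pi>\<^sub>E i\<in>I. \<Pi>\<^sub>E j\<in>K i. A (i, j))" by (simp add: PiE_iff)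
    next
      fix f assume f: "f \<in> (\<Pi>\<^sub>E i\<in>I. \<Pi>\<^sub>E j\<in>K i. A (i, j))"
      then have "f i j \<in> A (i, j)" if "i \<in> I" "j \<in> K i" for i j
        using that by (auto simp: PiE_iff)
      moreover from this have "f i j \<in> space L" if "i \<in> I" "j \<in> K i" for i j
        using that A[THEN sets.sets_into_space, of "(i, j)"] by auto
      moreover have "f \<in> extensional I" "\<And>i. i \<in> I \<Longrightarrow> f i \<in> extensional (K i)"
        using f by (auto simp: PiE_iff)
      ultimately show "f \<in> ?F -` Pi\<^sub>E ?S A \<inter> space ?Q" by (auto simp: space_PiM PiE_iff)
    qed
    then have "emeasure (distr ?Q ?P ?F) (Pi\<^sub>E ?S A) = emeasure ?Q (\<Pi>\<^sub>E i\<in>I. \<Pi>\<^sub>E j\<in>K i. A (i, j))"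
      using A S by (simp add: emeasure_distr[OF F] sets_PiM_I_finite)
    also have "\<dots> = (\<Prod>i\<in>I. \<Prod>j\<in>K i. emeasure L (A (i, j)))"
      using A K by (subst outer.emeasure_PiM[OF I])
        (auto intro!: sets_PiM_I_finite prod.cong inner.emeasure_PiM)
    also have "\<dots> = (\<Prod>p\<in>?S. emeasure L (A p))"
      using I K by (subst prod.Sigma) auto
    finally show "emeasure (distr ?Q ?P ?F) (Pi\<^sub>E ?S A) = (\<Prod>p\<in>?S. emeasure L (A p))" .
  qed simp
  have "(\<lambda>A. \<lambda>j\<in>K i. A (i, j)) \<in> ?P \<rightarrow>\<^sub>M Pi\<^sub>M (K i) (\<lambda>_. L)" if "i \<in> I" for i
    using that by (intro measurable_restrict measurable_component_singleton) auto
  then have "{A \<in> space ?P. (\<lambda>j\<in>K i. A (i, j)) \<in> G i} \<in> sets ?P" if "i \<in> I" for i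
    using measurable_sets[of "\<lambda>A. \<lambda>j\<in>K i. A (i, j)" ?P "Pi\<^sub>M (K i) (\<lambda>_. L)" "G i"] that G
    by (simp add: vimage_def Int_def conj_commute)
  then show D: "D \<in> sets ?P"
    unfolding D_def using I by (intro sets.sets_Collect_finite_All) auto
  have "?F -` D \<inter> space ?Q = Pi\<^sub>E I G"
  proof -
    \<comment> \<open>Restricting an uncurried family to the block \<open>i\<close> returns
      \<open>f i\<close> itself, because \<open>f i\<close> is extensional.\<close>
    have "(\<lambda>j\<in>K i. ?F f (i, j)) = f i" if "f \<in> space ?Q" "i \<in> I" for f i
      using that by (intro extensionalityI[of _ "K i"]) (auto simp: space_PiM PiE_iff)
    then have "?F f \<in> D \<longleftrightarrow> (\<forall>i\<in>I. f i \<in> G i)" if "f \<in> space ?Q" for f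
      using that measurable_space[OF F that] by (simp add: D_def)
    moreover have "Pi\<^sub>E I G \<subseteq> space ?Q"
      using G[THEN sets.sets_into_space] by (auto simp: space_PiM[of I] PiE_iff)
    ultimately show ?thesis by (auto simp: space_PiM[of I] PiE_iff)
  qed
  then have "emeasure (distr ?Q ?P ?F) D = emeasure ?Q (Pi\<^sub>E I G)"
    by (simp add: emeasure_distr[OF F D])
  also have "\<dots> = (\<Prod>i\<in>I. emeasure (Pi\<^sub>M (K i) (\<lambda>_. L)) (G i))"
    using G by (intro outer.emeasure_PiM I)
  finally show "emeasure ?P D = (\<Prod>i\<in>I. emeasure (Pi\<^sub>M (K i) (\<lambda>_. L)) (G i))"
    by (simp add: distr)
qed

section \<open>Logarithms of extended nonnegative reals\<close>

lemma elog_ennreal: "0 < a \<Longrightarrow> elog (ennreal a) = ereal (ln a)"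
  by (simp add: elog_def)

lemma elog_mono:
  assumes "x \<le> y"
  shows "elog x \<le> elog y"
proof (cases x; cases y)
  fix a b :: real
  assume "0 \<le> a" "x = ennreal a" "0 \<le> b" "y = ennreal b"
  then show ?thesis
    using assms by (cases "a = 0") (auto simp: elog_def ennreal_le_iff)
qed (use assms in \<open>auto simp: elog_def top_unique\<close>)

text \<open>Finite factors exclude \<open>0 * \<infinity>\<close>, for which the left side is
  \<open>-\<infinity>\<close> but the right side is \<open>\<infinity>\<close>.\<close>

lemma elog_mult:
  assumes "x \<noteq> \<infinity>" "y \<noteq> \<infinity>"
  shows "elog (x * y) = elog x + elog y"
proof (cases "x = 0 \<or> y = 0")
  case True
  then show ?thesis using assms by (auto simp: elog_def)
next
  case False
  with assms obtain a b where "x = ennreal a" "y = ennreal b" "0 < a" "0 < b"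
    by (cases x; cases y) (auto simp: less_le)
  then show ?thesis
    by (simp add: elog_ennreal ln_mult flip: ennreal_mult)
qed

lemma elog_prod:
  assumes "\<And>i. i \<in> I \<Longrightarrow> f i \<noteq> \<infinity>"
  shows "elog (\<Prod>i\<in>I. f i) = (\<Sum>i\<in>I. elog (f i))"
  using assms
proof (induction I rule: infinite_finite_induct)
  case (insert i I)
  then have "(\<Prod>i\<in>I. f i) \<noteq> \<infinity>" by (auto simp: ennreal_prod_eq_top)
  with insert show ?case by (simp add: elog_mult)
qed (simp_all add: elog_def)

section \<open>Orbital microstates\<close>

lemma conj_map_eq:
  "conj_map n r (U, A) = (\<lambda>p\<in>tuple_index n r. conj_mat (U (fst p)) (A p))"
  by (auto simp: conj_map_def conj_mat_def)

lemma haar_unitaryD: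
  assumes "haar_unitary N \<gamma>"
  shows "prob_space \<gamma>" "sets \<gamma> = sets (mat_borel N (unitary_group N))" "space \<gamma> = unitary_group N"
proof -
  show "prob_space \<gamma>" and sets: "sets \<gamma> = sets (mat_borel N (unitary_group N))"
    using assms by (auto simp: haar_unitary_def)
  show "space \<gamma> = unitary_group N"
    using sets_eq_imp_space_eq[OF sets] by simp
qed

lemma measurable_conj_map:
  assumes \<gamma>: "haar_unitary N \<gamma>"
    and \<mu>: "sets \<mu> = sets (\<Pi>\<^sub>M p\<in>tuple_index n r. mat_borel N (msa N))"
  shows "conj_map n r \<in> (Pi\<^sub>M {1..n} (\<lambda>_. \<gamma>)) \<Otimes>\<^sub>M \<mu> \<rightarrow>\<^sub>M (\<Pi>\<^sub>M p\<in>tuple_index n r. mat_borel N (msa N))"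
proof -
  let ?J = "tuple_index n r" and ?P = "Pi\<^sub>M {1..n} (\<lambda>_. \<gamma>) \<Otimes>\<^sub>M \<mu>"
  have "(\<lambda>x. conj_mat (fst x (fst p)) (snd x p)) \<in> ?P \<rightarrow>\<^sub>M mat_borel N (msa N)" if p: "p \<in> ?J" for p
  proof (rule measurable_mat_borel_conj_mat)
    have "fst p \<in> {1..n}" using p by (auto simp: tuple_index_def)
    then have "(\<lambda>U. U (fst p)) \<in> Pi\<^sub>M {1..n} (\<lambda>_. \<gamma>) \<rightarrow>\<^sub>M \<gamma>"
      by (rule measurable_component_singleton)
    then have "(\<lambda>x. fst x (fst p)) \<in> ?P \<rightarrow>\<^sub>M \<gamma>"
      by (rule measurable_compose[OF measurable_fst])
    then show "(\<lambda>x. fst x (fst p)) \<in> ?P \<rightarrow>\<^sub>M mat_borel N (unitary_group N)"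
      using haar_unitaryD(2)[OF \<gamma>] by (simp cong: measurable_cong_sets)
    have "snd \<in> ?P \<rightarrow>\<^sub>M (\<Pi>\<^sub>M p\<in>?J. mat_borel N (msa N))"
      using measurable_snd[of "Pi\<^sub>M {1..n} (\<lambda>_. \<gamma>)" \<mu>] by (simp add: \<mu> cong: measurable_cong_sets)
    then show "(\<lambda>x. snd x p) \<in> ?P \<rightarrow>\<^sub>M mat_borel N (msa N)"
      by (rule measurable_compose[OF _ measurable_component_singleton[OF p]])
  qed
  then have "(\<lambda>x. \<lambda>p\<in>?J. conj_mat (fst x (fst p)) (snd x p)) \<in> ?P \<rightarrow>\<^sub>M (\<Pi>\<^sub>M p\<in>?J. mat_borel N (msa N))"
    by (intro measurable_restrict)
  also have "(\<lambda>x. \<lambda>p\<in>?J. conj_mat (fst x (fst p)) (snd x p)) = conj_map n r"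
    by (rule ext) (metis conj_map_eq prod.collapse)
  finally show ?thesis .
qed

lemma orbital_microstates_measurable:
  assumes "haar_unitary N \<gamma>" "sets \<mu> = sets (\<Pi>\<^sub>M p\<in>tuple_index n r. mat_borel N (msa N))"
  defines "P \<equiv> Pi\<^sub>M {1..n} (\<lambda>_. \<gamma>) \<Otimes>\<^sub>M \<mu>"
  shows "conj_map n r -` microstates \<tau> (tuple_index n r) X (ereal R) N m \<delta> \<inter> space P \<in> sets P"
  unfolding P_def
proof (rule measurable_sets[OF measurable_conj_map[OF assms(1,2)]])
  show "microstates \<tau> (tuple_index n r) X (ereal R) N m \<delta> \<in> sets (\<Pi>\<^sub>M p\<in>tuple_index n r. mat_borel N (msa N))"
    by (intro microstates_measurable) (simp add: tuple_index_def)
qed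

text \<open>The comparison at one matrix size, before scaling and limits. A single measure bounds
  the supremum from below, and the logarithm splits because all measures involved are
  finite.\<close>

lemma emeasure_joint_microstates:
  fixes X :: "nat \<Rightarrow> nat \<Rightarrow> 'h::complex_hilbert_space \<Rightarrow>\<^sub>L 'h"
  assumes \<gamma>: "haar_unitary N (\<gamma> N)"
  shows "elog (emeasure (Lebesgue_tuple N (tuple_index n r))
      (microstates \<tau> (tuple_index n r) (\<lambda>(i, j). X i j) (ereal R) N m \<delta>))
    \<le> orb_entropy_approx \<gamma> \<tau> n r X (ereal R) N m \<delta>
      + (\<Sum>i = 1..n. elog (emeasure (Lebesgue_tuple N {1..r i})
          (microstates \<tau> {1..r i} (X i) (ereal R) N m \<delta>)))"
proof -
  let ?J = "tuple_index n r" and ?X = "\<lambda>(i, j). X i j"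
  let ?L = "Lebesgue_tuple N ?J" and ?\<Gamma> = "Pi\<^sub>M {1..n} (\<lambda>_. \<gamma> N)"
  define G where "G = microstates \<tau> ?J ?X (ereal R) N m \<delta>"
  define G' where "G' i = microstates \<tau> {1..r i} (X i) (ereal R) N m \<delta>" for i
  define D where "D = {A \<in> space ?L. \<forall>i\<in>{1..n}. (\<lambda>j\<in>{1..r i}. A (i, j)) \<in> G' i}"
  have J: "?J = Sigma {1..n} (\<lambda>i. {1..r i})" "finite ?J"
    by (auto simp: tuple_index_def)
  have G: "G \<in> sets ?L"
    using J by (simp add: G_def sets_Lebesgue_tuple microstates_measurable)
  have G': "G' i \<in> sets (Lebesgue_tuple N {1..r i})" for i
    by (simp add: G'_def sets_Lebesgue_tuple microstates_measurable)
  have D: "D \<in> sets ?L" and emeasure_D: "emeasure ?L D = (\<Prod>i=1..n. emeasure (Lebesgue_tuple N {1..r i}) (G' i))"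
    unfolding D_def J(1)
    using Lebesgue_msa.sigma_finite_measure_axioms G'
    by (intro emeasure_PiM_Sigma; simp)+
  have G'_finite: "emeasure (Lebesgue_tuple N {1..r i}) (G' i) \<noteq> \<infinity>" for i
    using emeasure_microstates_finite[of "{1..r i}" N \<tau> "X i" R m \<delta>]
    unfolding G'_def by (intro less_imp_neq) simp
  then have L_D: "emeasure ?L D \<noteq> \<infinity>"
    unfolding emeasure_D infinity_ennreal_def ennreal_prod_eq_top by blast
  have "G \<subseteq> D"
  proof
    fix A assume A: "A \<in> G"
    then have "A \<in> space ?L" using sets.sets_into_space[OF G] by auto
    moreover have "(\<lambda>j\<in>{1..r i}. A (i, j)) \<in> G' i" if "i \<in> {1..n}" for i
      using A that unfolding G_def G'_def by (intro microstates_reindex) (auto simp: tuple_index_def)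
    ultimately show "A \<in> D" by (simp add: D_def)
  qed
  show ?thesis
  proof (cases "emeasure ?L D = 0")
    case True
    \<comment> \<open>Normalization is impossible here, but the left side is then
      \<open>-\<infinity>\<close>, so the inequality is trivial.\<close>
    then have "emeasure ?L G = 0"
      using emeasure_mono[OF \<open>G \<subseteq> D\<close> D] by simp
    then show ?thesis by (simp add: G_def elog_def)
  next
    case False
    define \<mu> where "\<mu> = uniform_measure ?L D"
    interpret \<mu>: prob_space \<mu>
      unfolding \<mu>_def using False L_D by (rule prob_space_uniform_measure)
    have sets_\<mu>: "sets \<mu> = sets (\<Pi>\<^sub>M p\<in>?J. mat_borel N (msa N))"
      by (simp add: \<mu>_def sets_Lebesgue_tuple)
    interpret haar: prob_space "\<gamma> N"
      by (rule haar_unitaryD(1)[OF \<gamma>])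
    interpret \<Gamma>: finite_product_prob_space "\<lambda>_. \<gamma> N" "{1..n}"
      by standard auto
    let ?P = "?\<Gamma> \<Otimes>\<^sub>M \<mu>"
    let ?E = "conj_map n r -` G \<inter> space ?P"
    \<comment> \<open>The measure of the slice does not depend on \<open>U\<close>, which makes the
      Haar average over \<open>U\<close> trivial.\<close>
    have slice: "emeasure \<mu> (Pair U -` ?E) = emeasure ?L G / emeasure ?L D"
      if "U \<in> space ?\<Gamma>" for U
    proof -
      have U: "U i \<in> unitary_group N" if "i \<in> {1..n}" for i
        using \<open>U \<in> space ?\<Gamma>\<close> that by (auto simp: space_PiM haar_unitaryD(3)[OF \<gamma>])
      define c where "c A = (\<lambda>p\<in>?J. conj_mat (U (fst p)) (A p))" for A
      have fst_J: "fst p \<in> {1..n}" if "p \<in> ?J" for p using that by (auto simp: tuple_index_def)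
      have meas: "conj_mat (U (fst p)) \<in> Lebesgue_msa N \<rightarrow>\<^sub>M Lebesgue_msa N" if "p \<in> ?J" for p
        using measurable_mat_borel_conj_mat[of "\<lambda>_. U (fst p)" "mat_borel N (msa N)" N "\<lambda>A. A"]
          U[OF fst_J[OF that]] by (simp cong: measurable_cong_sets)
      then have c: "c \<in> ?L \<rightarrow>\<^sub>M ?L"
        unfolding c_def
        by (intro measurable_restrict measurable_compose[OF _ meas] measurable_component_singleton)
      have distr_c: "distr ?L ?L c = ?L"
        unfolding c_def using meas U fst_J J(2)
        by (intro Lebesgue_product.distr_PiM_measure_preserving distr_Lebesgue_msa_conj_mat) auto
      have slice_eq: "Pair U -` ?E = c -` G \<inter> space ?L"
        using that by (auto simp: space_pair_measure conj_map_eq c_def \<mu>_def)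
      \<comment> \<open>Restricting to \<open>D\<close> loses no point: \<open>c A\<close> lies in
        \<open>D\<close>, and \<open>D\<close> is invariant under conjugation of each block by its
        own unitary matrix.\<close>
      have "c -` G \<inter> space ?L \<subseteq> D"
      proof
        fix A assume A: "A \<in> c -` G \<inter> space ?L"
        have "(\<lambda>j\<in>{1..r i}. A (i, j)) \<in> G' i" if i: "i \<in> {1..n}" for i
        proof -
          have "c A \<in> D" using A \<open>G \<subseteq> D\<close> by auto
          then have "(\<lambda>j\<in>{1..r i}. c A (i, j)) \<in> G' i" using i by (simp add: D_def)
          also have "(\<lambda>j\<in>{1..r i}. c A (i, j)) =
            (\<lambda>j\<in>{1..r i}. conj_mat (U i) ((\<lambda>j\<in>{1..r i}. A (i, j)) j))"
            using i by (auto simp: c_def tuple_index_def)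
          finally show ?thesis
            using A i unfolding G'_def
            by (subst (asm) microstates_conj_mat_iff[OF U[OF i]])
              (auto simp: space_Lebesgue_tuple tuple_index_def PiE_iff)
        qed
        then show "A \<in> D" using A by (simp add: D_def)
      qed
      then have "D \<inter> (c -` G \<inter> space ?L) = c -` G \<inter> space ?L" by auto
      then have "emeasure \<mu> (Pair U -` ?E) = emeasure ?L (c -` G \<inter> space ?L) / emeasure ?L D"
        unfolding slice_eq unfolding \<mu>_def using D measurable_sets[OF c G] by simp
      also have "emeasure ?L (c -` G \<inter> space ?L) = emeasure ?L G"
        using emeasure_distr[OF c G] by (simp add: distr_c)
      finally show ?thesis .
    qed
    have "?E \<in> sets ?P"
      unfolding G_def by (rule orbital_microstates_measurable[OF \<gamma> sets_\<mu>])
    then have "emeasure ?P ?E = (\<integral>\<^sup>+U. emeasure \<mu> (Pair U -` ?E) \<partial>?\<Gamma>)"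
      by (rule \<mu>.emeasure_pair_measure_alt)
    also have "\<dots> = (\<integral>\<^sup>+U. emeasure ?L G / emeasure ?L D \<partial>?\<Gamma>)"
      by (intro nn_integral_cong slice)
    \<comment> \<open>The integrand is constant and the product of the Haar measures has total mass
      1.\<close>
    also have "\<dots> = emeasure ?L G / emeasure ?L D"
      using \<Gamma>.emeasure_space_1 by simp
    finally have E: "emeasure ?P ?E = emeasure ?L G / emeasure ?L D" .
    \<comment> \<open>The division is undone; the measure of \<open>D\<close> is finite and
      nonzero.\<close>
    have "emeasure ?L G = emeasure ?P ?E * emeasure ?L D"
      unfolding E using False L_D by (simp add: ennreal_divide_times ennreal_divide_self less_top)
    moreover have "emeasure ?P ?E \<noteq> \<infinity>"
      using emeasure_microstates_finite[OF J(2), of N \<tau> ?X R m \<delta>] False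
      unfolding E unfolding G_def infinity_ennreal_def ennreal_divide_eq_top_iff by auto
    ultimately have "elog (emeasure ?L G) = elog (emeasure ?P ?E) + elog (emeasure ?L D)"
      using L_D by (simp add: elog_mult)
    also have "elog (emeasure ?L D) = (\<Sum>i=1..n. elog (emeasure (Lebesgue_tuple N {1..r i}) (G' i)))"
      unfolding emeasure_D by (rule elog_prod) (rule G'_finite)
    finally have eq: "elog (emeasure ?L G) = elog (emeasure ?P ?E) +
      (\<Sum>i=1..n. elog (emeasure (Lebesgue_tuple N {1..r i}) (G' i)))" .
    have "\<mu> \<in> borel_probs N ?J"
      using sets_\<mu> \<mu>.prob_space_axioms by (simp add: borel_probs_def)
    then have "elog (emeasure ?P ?E) \<le> orb_entropy_approx \<gamma> \<tau> n r X (ereal R) N m \<delta>"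
      unfolding orb_entropy_approx_def Let_def G_def by (rule SUP_upper)
    then show ?thesis
      using eq by (simp add: G_def G'_def add_right_mono)
  qed
qed

text \<open>For each \<mu> the preimages of the microstate sets are nested. Comparing their measures
  asks for measurability of the larger one, whence the assumption on
  \<open>\<gamma> N\<close>.\<close>

lemma orb_entropy_approx_mono:
  assumes "haar_unitary N (\<gamma> N)" "m' \<le> m" "\<delta> \<le> \<delta>'"
  shows "orb_entropy_approx \<gamma> \<tau> n r X (ereal R) N m \<delta> \<le> orb_entropy_approx \<gamma> \<tau> n r X (ereal R) N m' \<delta>'"
  unfolding orb_entropy_approx_def Let_def
  by (intro SUP_mono' SUP_subset_mono elog_mono emeasure_mono orbital_microstates_measurable assms
      Int_mono vimage_mono microstates_mono order_refl) (simp add: borel_probs_def)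

section \<open>Limits superior along filters\<close>

text \<open>If one limit superior is \<open>\<infinity>\<close>, so is the right side, by the
  convention for sums. Otherwise every finite \<open>z\<close> above the right side is split as
  \<open>a + (z - a)\<close>, with the summands strictly above the two limits superior.\<close>

lemma Limsup_add_le:
  fixes u v :: "'a \<Rightarrow> ereal"
  shows "Limsup F (\<lambda>x. u x + v x) \<le> Limsup F u + Limsup F v"
proof (cases "Limsup F u = \<infinity> \<or> Limsup F v = \<infinity>")
  case False
  show ?thesis
  proof (rule dense_ge)
    fix z assume z: "Limsup F u + Limsup F v < z"
    show "Limsup F (\<lambda>x. u x + v x) \<le> z"
    proof (cases "z = \<infinity>")
      case z_fin: False
      have "Limsup F u < z - Limsup F v"
        using z False by (simp add: ereal_less_minus_iff)
      then obtain a where a: "Limsup F u < a" "a < z - Limsup F v"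
        using dense by blast
      then have a_fin: "\<bar>a\<bar> \<noteq> \<infinity>" by auto
      have b: "Limsup F v < z - a"
        using a z z_fin False a_fin
        by (cases a; cases z; cases "Limsup F v") auto
      have "eventually (\<lambda>x. u x + v x \<le> z) F"
        using Limsup_lessD[OF a(1)] Limsup_lessD[OF b]
      proof eventually_elim
        case (elim x)
        then have "u x + v x \<le> a + (z - a)" by (intro add_mono) auto
        also have "\<dots> = z" using a_fin by (cases a; cases z) auto
        finally show ?case .
      qed
      then show ?thesis by (rule Limsup_bounded)
    qed simp
  qed
qed auto

lemma Limsup_sum_le:
  fixes u :: "'i \<Rightarrow> 'a \<Rightarrow> ereal"
  assumes "F \<noteq> bot"
  shows "Limsup F (\<lambda>x. \<Sum>i\<in>I. u i x) \<le> (\<Sum>i\<in>I. Limsup F (u i))"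
proof (induction I rule: infinite_finite_induct)
  case (insert i I)
  have "Limsup F (\<lambda>x. \<Sum>j\<in>insert i I. u j x) \<le> Limsup F (u i) + Limsup F (\<lambda>x. \<Sum>j\<in>I. u j x)"
    using insert.hyps Limsup_add_le[of F "u i" "\<lambda>x. \<Sum>j\<in>I. u j x"] by simp
  also have "\<dots> \<le> Limsup F (u i) + (\<Sum>j\<in>I. Limsup F (u j))"
    by (intro add_left_mono insert.IH)
  finally show ?case using insert.hyps by simp
qed (simp_all add: Limsup_const[OF assms])

abbreviation microstate_filter :: "(nat \<times> real) filter" where
  "microstate_filter \<equiv> sequentially \<times>\<^sub>F at_right 0"

lemma microstate_filter_neq_bot: "microstate_filter \<noteq> bot"
  by (simp add: prod_filter_eq_bot)

text \<open>No value lies below the infimum, and by monotonicity all values after one below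
  \<open>c\<close> stay below \<open>c\<close>. Thus the \<open>Lim\<close> in
  \<open>free_entropy\<close> and the infimum in \<open>orb_entropy_R\<close> both become limits
  superior along one filter.\<close>

lemma microstate_filter_tendsto_INF:
  fixes \<phi> :: "nat \<Rightarrow> real \<Rightarrow> ereal"
  assumes mono: "\<And>m m' \<delta> \<delta>'. m' \<le> m \<Longrightarrow> \<delta> \<le> \<delta>' \<Longrightarrow> \<phi> m \<delta> \<le> \<phi> m' \<delta>'"
  shows "((\<lambda>(m, \<delta>). \<phi> m \<delta>) \<longlongrightarrow> (INF (m, \<delta>)\<in>{1..} \<times> {0<..}. \<phi> m \<delta>)) microstate_filter"
proof (rule order_tendstoI)
  have ev: "eventually (\<lambda>(m, \<delta>). k \<le> m \<and> 0 < \<delta> \<and> \<delta> \<le> d) microstate_filter" if "0 < d" for k d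
  proof -
    have "eventually (\<lambda>\<delta>::real. 0 < \<delta> \<and> \<delta> \<le> d) (at_right 0)"
      using that by (auto simp: eventually_at_right_field intro!: exI[of _ d])
    from eventually_prodI[OF eventually_ge_at_top[of k] this]
    show ?thesis by (rule eventually_mono) auto
  qed
  fix c
  {
    assume c: "c < (INF (m, \<delta>)\<in>{1..} \<times> {0<..}. \<phi> m \<delta>)"
    show "eventually (\<lambda>x. c < (case x of (m, \<delta>) \<Rightarrow> \<phi> m \<delta>)) microstate_filter"
      using ev[of 1 1, simplified]
    proof (rule eventually_mono, clarify)
      fix m :: nat and \<delta> :: real assume "Suc 0 \<le> m" "0 < \<delta>"
      then show "c < \<phi> m \<delta>"
        using c INF_lower[of "(m, \<delta>)" "{1..} \<times> {0<..}" "\<lambda>(m, \<delta>). \<phi> m \<delta>"] by auto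
    qed
  }
  {
    assume "(INF (m, \<delta>)\<in>{1..} \<times> {0<..}. \<phi> m \<delta>) < c"
    then obtain m d where md: "0 < d" "\<phi> m d < c" by (auto simp: INF_less_iff)
    show "eventually (\<lambda>x. (case x of (m, \<delta>) \<Rightarrow> \<phi> m \<delta>) < c) microstate_filter"
      using ev[OF md(1), of m]
    proof (rule eventually_mono, clarify)
      fix m' :: nat and \<delta> :: real assume "m \<le> m'" "\<delta> \<le> d"
      then show "\<phi> m' \<delta> < c" using mono[of m m' \<delta> d] md(2) by auto
    qed
  }
qed

section \<open>Entropies as limits superior\<close>

text \<open>The expression under the innermost limit superior of \<open>free_entropy\<close>, for a
  real radius.\<close>

definition entropy_density ::
    "(('h::complex_hilbert_space \<Rightarrow>\<^sub>L 'h) \<Rightarrow> complex) \<Rightarrow> 'i set \<Rightarrow> ('i \<Rightarrow> 'h \<Rightarrow>\<^sub>L 'h) \<Rightarrow>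
     real \<Rightarrow> nat \<Rightarrow> nat \<Rightarrow> real \<Rightarrow> ereal" where
  "entropy_density \<tau> I X R N m \<delta> =
     ereal (1 / real N ^ 2) * elog (emeasure (Lebesgue_tuple N I) (microstates \<tau> I X (ereal R) N m \<delta>))
     + ereal (real (card I) / 2 * ln (real N))"

lemma entropy_density_mono:
  assumes "finite I" "m' \<le> m" "\<delta> \<le> \<delta>'"
  shows "entropy_density \<tau> I X R N m \<delta> \<le> entropy_density \<tau> I X R N m' \<delta>'"
  unfolding entropy_density_def
  by (intro add_right_mono ereal_mult_left_mono elog_mono emeasure_mono microstates_mono assms)
    (simp_all add: sets_Lebesgue_tuple microstates_measurable assms)

text \<open>\<open>Lim\<close> is meaningful only where a limit exists. By monotonicity it does, and
  the limit superior that replaces it is subadditive.\<close>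

lemma Lim_entropy_density:
  assumes "finite I"
  shows "Lim microstate_filter (\<lambda>(m, \<delta>). limsup (\<lambda>N. entropy_density \<tau> I X R N m \<delta>)) =
    Limsup microstate_filter (\<lambda>(m, \<delta>). limsup (\<lambda>N. entropy_density \<tau> I X R N m \<delta>))"
proof -
  have tendsto: "((\<lambda>(m, \<delta>). limsup (\<lambda>N. entropy_density \<tau> I X R N m \<delta>)) \<longlongrightarrow>
    (INF (m, \<delta>)\<in>{1..} \<times> {0<..}. limsup (\<lambda>N. entropy_density \<tau> I X R N m \<delta>))) microstate_filter"
    by (intro microstate_filter_tendsto_INF Limsup_mono always_eventually allI entropy_density_mono assms)
  show ?thesis
    using tendsto_Lim[OF microstate_filter_neq_bot tendsto]
      lim_imp_Limsup[OF microstate_filter_neq_bot tendsto] by simp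
qed

text \<open>Measurability and finiteness of microstate sets were proved for real radii, so the
  suprema are rewritten over these.\<close>

lemma SUP_ereal_positive_real: "(SUP R\<in>{0<..<\<infinity>::ereal}. f R) = (SUP R\<in>{0<..}. f (ereal R))"
proof -
  have "{0<..<\<infinity>::ereal} = ereal ` {0<..}"
  proof (intro subset_antisym subsetI)
    fix x :: ereal assume "x \<in> {0<..<\<infinity>}"
    then show "x \<in> ereal ` {0<..}" by (cases x) auto
  qed auto
  then show ?thesis by (simp add: image_image)
qed

lemma free_entropy_eq:
  assumes "finite I"
  shows "free_entropy \<tau> I X =
    (SUP R\<in>{0<..}. Limsup microstate_filter (\<lambda>(m, \<delta>). limsup (\<lambda>N. entropy_density \<tau> I X R N m \<delta>)))"
  unfolding free_entropy_def SUP_ereal_positive_real Lim_entropy_density[OF assms, symmetric]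
  unfolding entropy_density_def ..

lemma orb_entropy_R_eq:
  assumes "\<And>N. N \<ge> 1 \<Longrightarrow> haar_unitary N (\<gamma> N)"
  shows "orb_entropy_R \<gamma> \<tau> n r X (ereal R) = Limsup microstate_filter
    (\<lambda>(m, \<delta>). limsup (\<lambda>N. ereal (1 / real N ^ 2) * orb_entropy_approx \<gamma> \<tau> n r X (ereal R) N m \<delta>))"
proof -
  have "limsup (\<lambda>N. ereal (1 / real N ^ 2) * orb_entropy_approx \<gamma> \<tau> n r X (ereal R) N m \<delta>)
    \<le> limsup (\<lambda>N. ereal (1 / real N ^ 2) * orb_entropy_approx \<gamma> \<tau> n r X (ereal R) N m' \<delta>')"
    if "m' \<le> m" "\<delta> \<le> \<delta>'" for m m' \<delta> \<delta>'
  \<comment> \<open>Haar measure is assumed for \<open>N \<ge> 1\<close>, so the terms are compared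
    eventually.\<close>
  proof (intro Limsup_mono eventually_mono[OF eventually_ge_at_top[of 1]] ereal_mult_left_mono)
    fix N :: nat assume "1 \<le> N"
    then show "orb_entropy_approx \<gamma> \<tau> n r X (ereal R) N m \<delta> \<le> orb_entropy_approx \<gamma> \<tau> n r X (ereal R) N m' \<delta>'"
      using that by (intro orb_entropy_approx_mono assms)
  qed simp
  from lim_imp_Limsup[OF microstate_filter_neq_bot microstate_filter_tendsto_INF, OF this]
  show ?thesis by (simp add: orb_entropy_R_def)
qed

text \<open>The joint tuple has as many indices as all blocks together, so the terms with
  \<open>ln (real N)\<close> on the two sides agree.\<close>

lemma joint_entropy_density_le:
  assumes "haar_unitary N (\<gamma> N)"
  shows "entropy_density \<tau> (tuple_index n r) (\<lambda>(i, j). X i j) R N m \<delta>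
    \<le> ereal (1 / real N ^ 2) * orb_entropy_approx \<gamma> \<tau> n r X (ereal R) N m \<delta>
      + (\<Sum>i = 1..n. entropy_density \<tau> {1..r i} (X i) R N m \<delta>)"
proof -
  let ?c = "1 / real N ^ 2"
  let ?e = "\<lambda>i. elog (emeasure (Lebesgue_tuple N {1..r i}) (microstates \<tau> {1..r i} (X i) (ereal R) N m \<delta>))"
  let ?O = "orb_entropy_approx \<gamma> \<tau> n r X (ereal R) N m \<delta>"
  have "ereal ?c * elog (emeasure (Lebesgue_tuple N (tuple_index n r))
      (microstates \<tau> (tuple_index n r) (\<lambda>(i, j). X i j) (ereal R) N m \<delta>))
    \<le> ereal ?c * (?O + (\<Sum>i = 1..n. ?e i))"
    by (intro ereal_mult_left_mono emeasure_joint_microstates assms) simp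
  \<comment> \<open>A nonnegative finite factor distributes over sums with infinite summands as
    well.\<close>
  also have "\<dots> = ereal ?c * ?O + ereal ?c * (\<Sum>i = 1..n. ?e i)"
    by (rule ereal_pos_distrib) auto
  also have "ereal ?c * (\<Sum>i = 1..n. ?e i) = (\<Sum>i = 1..n. ereal ?c * ?e i)"
    using sum_distrib_right_ereal[of ?c ?e "{1..n}"] by (simp add: mult.commute)
  finally have "entropy_density \<tau> (tuple_index n r) (\<lambda>(i, j). X i j) R N m \<delta>
    \<le> ereal ?c * ?O + (\<Sum>i = 1..n. ereal ?c * ?e i)
      + ereal (real (card (tuple_index n r)) / 2 * ln (real N))"
    unfolding entropy_density_def by (rule add_right_mono)
  also have "ereal (real (card (tuple_index n r)) / 2 * ln (real N)) =
    (\<Sum>i = 1..n. ereal (real (card {1..r i}) / 2 * ln (real N)))"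
    by (simp add: tuple_index_def sum_divide_distrib sum_distrib_right)
  finally show ?thesis
    by (simp add: entropy_density_def sum.distrib add.assoc)
qed

theorem proposition2p8:
  fixes M :: "('h::complex_hilbert_space \<Rightarrow>\<^sub>L 'h) set"
    and \<tau> :: "('h \<Rightarrow>\<^sub>L 'h) \<Rightarrow> complex"
    and n :: nat
    and r :: "nat \<Rightarrow> nat"
    and X :: "nat \<Rightarrow> nat \<Rightarrow> 'h \<Rightarrow>\<^sub>L 'h"
    and \<gamma> :: "nat \<Rightarrow> complex mat measure"
  assumes "tracial_W_prob_space M \<tau>"
    and "\<And>i j. i \<in> {1..n} \<Longrightarrow> j \<in> {1..r i} \<Longrightarrow> X i j \<in> self_adjoint_part M"
    and "\<And>N. N \<ge> 1 \<Longrightarrow> haar_unitary N (\<gamma> N)"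
  shows "free_entropy \<tau> (tuple_index n r) (\<lambda>(i, j). X i j)
    \<le> orb_free_entropy \<gamma> \<tau> n r X + (\<Sum>i = 1..n. free_entropy \<tau> {1..r i} (X i))"
proof -
  have "finite (tuple_index n r)" by (simp add: tuple_index_def)
  then have "free_entropy \<tau> (tuple_index n r) (\<lambda>(i, j). X i j) = (SUP R\<in>{0<..}.
    Limsup microstate_filter (\<lambda>(m, \<delta>). limsup (\<lambda>N. entropy_density \<tau> (tuple_index n r) (\<lambda>(i, j). X i j) R N m \<delta>)))"
    by (rule free_entropy_eq)
  also have "\<dots> \<le> orb_free_entropy \<gamma> \<tau> n r X + (\<Sum>i = 1..n. free_entropy \<tau> {1..r i} (X i))"
  proof (rule SUP_least)
    \<comment> \<open>One radius is used for all terms; the suprema on the right are introduced at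
      the end, separately for each summand.\<close>
    fix R :: real assume R: "R \<in> {0<..}"
    define f where "f = (\<lambda>(m, \<delta>). limsup (\<lambda>N. entropy_density \<tau> (tuple_index n r) (\<lambda>(i, j). X i j) R N m \<delta>))"
    define g where "g = (\<lambda>(m, \<delta>). limsup (\<lambda>N. ereal (1 / real N ^ 2) * orb_entropy_approx \<gamma> \<tau> n r X (ereal R) N m \<delta>))"
    define h where "h i = (\<lambda>(m, \<delta>). limsup (\<lambda>N. entropy_density \<tau> {1..r i} (X i) R N m \<delta>))" for i
    \<comment> \<open>Subadditivity is used at two levels: here for the limit superior in
      \<open>N\<close>, below for the one in \<open>m\<close> and \<delta>.\<close>
    have "f (m, \<delta>) \<le> g (m, \<delta>) + (\<Sum>i = 1..n. h i (m, \<delta>))" for m \<delta>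
    proof -
      have "f (m, \<delta>) \<le> limsup (\<lambda>N. ereal (1 / real N ^ 2) * orb_entropy_approx \<gamma> \<tau> n r X (ereal R) N m \<delta>
        + (\<Sum>i = 1..n. entropy_density \<tau> {1..r i} (X i) R N m \<delta>))"
        unfolding f_def prod.case
        by (intro Limsup_mono eventually_mono[OF eventually_ge_at_top[of 1]] joint_entropy_density_le assms(3))
      also have "\<dots> \<le> g (m, \<delta>) + limsup (\<lambda>N. \<Sum>i = 1..n. entropy_density \<tau> {1..r i} (X i) R N m \<delta>)"
        unfolding g_def prod.case by (rule Limsup_add_le)
      also have "\<dots> \<le> g (m, \<delta>) + (\<Sum>i = 1..n. h i (m, \<delta>))"
        unfolding h_def prod.case by (intro add_left_mono Limsup_sum_le sequentially_bot)
      finally show ?thesis .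
    qed
    then have "Limsup microstate_filter f \<le> Limsup microstate_filter (\<lambda>x. g x + (\<Sum>i = 1..n. h i x))"
      by (intro Limsup_mono always_eventually) auto
    also have "\<dots> \<le> Limsup microstate_filter g + Limsup microstate_filter (\<lambda>x. \<Sum>i = 1..n. h i x)"
      by (rule Limsup_add_le)
    also have "\<dots> \<le> Limsup microstate_filter g + (\<Sum>i = 1..n. Limsup microstate_filter (h i))"
      by (intro add_left_mono Limsup_sum_le microstate_filter_neq_bot)
    \<comment> \<open>Each term at radius \<open>R\<close> is one of those over which the
      corresponding supremum is taken.\<close>
    also have "\<dots> \<le> orb_free_entropy \<gamma> \<tau> n r X + (\<Sum>i = 1..n. free_entropy \<tau> {1..r i} (X i))"
    proof (intro add_mono sum_mono)
      have "Limsup microstate_filter g = orb_entropy_R \<gamma> \<tau> n r X (ereal R)"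
        unfolding g_def using assms(3) by (rule orb_entropy_R_eq[symmetric])
      also have "\<dots> \<le> orb_free_entropy \<gamma> \<tau> n r X"
        unfolding orb_free_entropy_def SUP_ereal_positive_real using R by (rule SUP_upper)
      finally show "Limsup microstate_filter g \<le> orb_free_entropy \<gamma> \<tau> n r X" .
      show "Limsup microstate_filter (h i) \<le> free_entropy \<tau> {1..r i} (X i)" for i
        unfolding h_def free_entropy_eq[OF finite_atLeastAtMost] using R by (rule SUP_upper)
    qed
    finally show "Limsup microstate_filter
      (\<lambda>(m, \<delta>). limsup (\<lambda>N. entropy_density \<tau> (tuple_index n r) (\<lambda>(i, j). X i j) R N m \<delta>))
      \<le> orb_free_entropy \<gamma> \<tau> n r X + (\<Sum>i = 1..n. free_entropy \<tau> {1..r i} (X i))"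
      unfolding f_def .
  qed
  finally show ?thesis .
qed

end
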